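(* Assume that $T\coloneqq A+G:V\to V^*$ is weakly coercive, i.e., $$|||T(v)|||_*\to\infty\quad\text{as}\quad |||v|||\to\infty\text{ with }v\in V.$$ Let $\mathcal{O}\subset V^*$ denote the set of all right-hand sides $F\in V^*$ such that all roots $u\in V$ of $N=A+G-F$ are regular. Then $\mathcal{O}$ is a dense open subset of $V^*$ and, for any $F\in\mathcal{O}$, there are at most finitely many (possibly zero) roots $u\in V$ of $N$, i.e., $|T^{-1}(F)|<\infty$ if $F\in\mathcal{O}$.
   Context: $(V,a)$ is a (real) Hilbert space with scalar product $a(\cdot,\cdot)$ and induced norm $|||v|||=a(v,v)^{1/2}$; $V^*$ is its dual with the operator norm $|||\cdot|||_*$. $A\in L(V;V^* )$, $Av\coloneqq a(v,\cdot)$, is the isometry induced by $a$. $G\in C^1(V;V^* )$ is a (nonlinear) compact operator, i.e., continuous and mapping bounded sets to relatively compact sets. For $F\in V^*$ define $N\in C^1(V;V^* )$ by $N(v)\coloneqq a(v,\cdot)+G(v)-F$. A root of $N$ is a $u\in V$ with $N(u)=0$, equivalently $T(u)=F$. A root $u$ is called regular if the Fréchet derivative $DN(u)=A+DG(u)\in L(V;V^* )$ is bijective. *)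

theory Defs
  imports "HOL-Analysis.Analysis"
begin

text \<open>
  The Hilbert space V is a type of class \<open>{real_inner, complete_space}\<close>; the scalar product a is
  \<open>inner\<close> and the induced norm is \<open>norm\<close>. The dual of V is \<open>'v \<Rightarrow>\<^sub>L real\<close>, whose \<open>norm\<close> is the
  operator norm.
\<close>

definition C1 :: "('a::real_normed_vector \<Rightarrow> 'b::real_normed_vector) \<Rightarrow> bool" where
  "C1 f \<longleftrightarrow> (\<exists>f' :: 'a \<Rightarrow> 'a \<Rightarrow>\<^sub>L 'b.
     (\<forall>x. (f has_derivative blinfun_apply (f' x)) (at x)) \<and> continuous_on UNIV f')"

definition compact_operator :: "('a::real_normed_vector \<Rightarrow> 'b::real_normed_vector) \<Rightarrow> bool" where
  "compact_operator f \<longleftrightarrow>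
     continuous_on UNIV f \<and> (\<forall>S. bounded S \<longrightarrow> compact (closure (f ` S)))"

definition op_A :: "'v::real_inner \<Rightarrow> 'v \<Rightarrow>\<^sub>L real" where
  "op_A v = blinfun_inner_right v"

definition op_T :: "('v::real_inner \<Rightarrow> 'v \<Rightarrow>\<^sub>L real) \<Rightarrow> 'v \<Rightarrow> 'v \<Rightarrow>\<^sub>L real" where
  "op_T G v = op_A v + G v"

definition op_N :: "('v::real_inner \<Rightarrow> 'v \<Rightarrow>\<^sub>L real) \<Rightarrow> ('v \<Rightarrow>\<^sub>L real) \<Rightarrow> 'v \<Rightarrow> 'v \<Rightarrow>\<^sub>L real" where
  "op_N G F v = op_A v + G v - F"

definition weakly_coercive :: "('a::real_normed_vector \<Rightarrow> 'b::real_normed_vector) \<Rightarrow> bool" where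
  "weakly_coercive f \<longleftrightarrow> filterlim (\<lambda>v. norm (f v)) at_top at_infinity"

definition is_root :: "('a \<Rightarrow> 'b::zero) \<Rightarrow> 'a \<Rightarrow> bool" where
  "is_root f u \<longleftrightarrow> f u = 0"

definition regular_root :: "('a::real_normed_vector \<Rightarrow> 'b::real_normed_vector) \<Rightarrow> 'a \<Rightarrow> bool" where
  "regular_root f u \<longleftrightarrow> is_root f u \<and> bij (frechet_derivative f (at u))"

definition regular_rhs :: "('v::real_inner \<Rightarrow> 'v \<Rightarrow>\<^sub>L real) \<Rightarrow> ('v \<Rightarrow>\<^sub>L real) set" where
  "regular_rhs G = {F. \<forall>u. is_root (op_N G F) u \<longrightarrow> regular_root (op_N G F) u}"

lemma op_A_apply: "blinfun_apply (op_A v) w = v \<bullet> w"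
  by (simp add: op_A_def)

text \<open>
  For differentiable G the choice-based \<^const>\<open>frechet_derivative\<close> in \<^const>\<open>regular_root\<close> is A + DG(u).
\<close>

lemma frechet_derivative_op_N:
  assumes "(G has_derivative blinfun_apply G') (at u)"
  shows "frechet_derivative (op_N G F) (at u) = (\<lambda>h. op_A h + blinfun_apply G' h)"
proof -
  have "(op_A has_derivative op_A) (at u)"
    unfolding op_A_def[abs_def] by (rule bounded_linear_imp_has_derivative[OF bounded_linear_blinfun_inner_right])
  from has_derivative_diff[OF has_derivative_add[OF this assms] has_derivative_const[of F]]
  have "(op_N G F has_derivative (\<lambda>h. op_A h + blinfun_apply G' h)) (at u)"
    by (simp add: op_N_def[abs_def])
  then show ?thesis by (rule frechet_derivative_at[symmetric])
qed

end

theory Submission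
  imports Defs
begin

text \<open>
  The Riesz isometry turns \<open>T\<close> into \<open>t = id + g\<close> on \<open>V\<close> with \<open>g\<close> compact; weak coercivity makes \<open>t\<close>
  proper. The right-hand sides that are not regular form the image under \<open>t\<close> of the critical set, which is
  closed because \<open>id + Dg(u)\<close>, being a compact perturbation of the identity, is bounded below as soon as
  it is injective. Density is the Sard-Smale theorem: by properness it is enough that the critical points
  in a small ball do not map onto an open set. Splitting off a finite-rank part \<open>P Dg(u0)\<close> leaves a
  map that is bi-Lipschitz near \<open>u0\<close>, and in its coordinates \<open>t\<close> is a map between finite-dimensional
  affine spaces parallel to the range of \<open>P\<close>. The dimension is not available as a type, so Sard's
  theorem is proved by counting grid points, without measure theory. Finally, regular roots are isolated
  and the set of all roots is compact, hence finite.
\<close>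

section \<open>Riesz representation and perturbation of bijections\<close>

lemma norm_op_A: "norm (op_A v) = norm v" for v :: "'v::real_inner"
proof (rule antisym)
  show "norm (op_A v) \<le> norm v"
    by (rule norm_blinfun_bound) (simp_all add: op_A_apply Cauchy_Schwarz_ineq2)
  have "norm v * norm v = norm (blinfun_apply (op_A v) v)"
    by (simp add: op_A_apply power2_eq_square[symmetric] dot_square_norm)
  also have "\<dots> \<le> norm (op_A v) * norm v"
    by (rule norm_blinfun)
  finally show "norm v \<le> norm (op_A v)"
    by (cases "v = 0") auto
qed

lemma op_A_diff: "op_A (v - w) = op_A v - op_A w"
  by (rule blinfun_eqI) (simp add: op_A_apply blinfun.bilinear_simps inner_simps)

lemma op_A_add: "op_A (v + w) = op_A v + op_A w"
  by (rule blinfun_eqI) (simp add: op_A_apply blinfun.bilinear_simps inner_simps)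

text \<open>The representing vector minimises the energy \<open>J\<close>. The parallelogram
  identity \<open>mid\<close> makes a minimising sequence Cauchy, completeness gives a minimiser
  \<open>u\<close>, and minimality along every line through \<open>u\<close> is the equation
  \<open>u \<bullet> w = f w\<close>.\<close>

lemma riesz_representation:
  fixes f :: "'v::{real_inner,complete_space} \<Rightarrow>\<^sub>L real"
  obtains v where "op_A v = f"
proof -
  define J where "J v = v \<bullet> v / 2 - f v" for v
  have mid: "J v + J w - 2 * J ((1/2) *\<^sub>R (v + w)) = (norm (v - w))\<^sup>2 / 4" for v w
    unfolding J_def power2_norm_eq_inner
    by (simp add: blinfun.bilinear_simps inner_simps inner_commute field_simps)
  have lb: "- (norm f)\<^sup>2 / 2 \<le> J v" for v
  proof -
    have "f v \<le> norm f * norm v"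
      using norm_blinfun[of f v] by simp
    moreover have "0 \<le> (norm f - norm v)\<^sup>2" by simp
    ultimately show ?thesis
      unfolding J_def by (simp add: power2_diff dot_square_norm)
  qed
  define d where "d = (INF v. J v)"
  have bdd: "bdd_below (range J)" using lb by (auto intro!: bdd_belowI2)
  have dle: "d \<le> J v" for v unfolding d_def by (rule cINF_lower[OF bdd]) simp
  have "\<exists>v. J v < d + 1 / real (Suc n)" for n
    using cInf_lessD[of "range J" "d + 1 / real (Suc n)"] by (auto simp: d_def)
  then obtain X where X: "J (X n) < d + 1 / real (Suc n)" for n by metis
  have dist2: "(norm (X m - X n))\<^sup>2 \<le> 4 * (1 / real (Suc m) + 1 / real (Suc n))" for m n
    using mid[of "X m" "X n"] X[of m] X[of n] dle[of "(1/2) *\<^sub>R (X m + X n)"] by argo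
  have "Cauchy X"
  proof (rule metric_CauchyI)
    fix e :: real assume "0 < e"
    then obtain N where N: "1 / real (Suc N) < e\<^sup>2 / 8"
      using reals_Archimedean[of "e\<^sup>2 / 8"] by (auto simp: inverse_eq_divide)
    show "\<exists>M. \<forall>m\<ge>M. \<forall>n\<ge>M. dist (X m) (X n) < e"
    proof (intro exI allI impI)
      fix m n assume "N \<le> m" "N \<le> n"
      then have "1 / real (Suc m) \<le> 1 / real (Suc N)" "1 / real (Suc n) \<le> 1 / real (Suc N)"
        by (auto simp: field_simps)
      then have "(norm (X m - X n))\<^sup>2 < e\<^sup>2" using dist2[of m n] N by argo
      then show "dist (X m) (X n) < e"
        using \<open>0 < e\<close> by (simp add: dist_norm power2_less_imp_less)
    qed
  qed
  then obtain u where u: "X \<longlonglongrightarrow> u"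
    using Cauchy_convergent convergent_def by blast
  have "(\<lambda>n. J (X n)) \<longlonglongrightarrow> J u"
    unfolding J_def using u by (intro tendsto_intros) auto
  moreover have "(\<lambda>n. d + 1 / real (Suc n)) \<longlonglongrightarrow> d + 0"
    using LIMSEQ_inverse_real_of_nat by (intro tendsto_intros) (simp add: inverse_eq_divide)
  ultimately have Ju: "J u \<le> d"
    using X by (intro LIMSEQ_le[of "\<lambda>n. J (X n)" _ "\<lambda>n. d + 1 / real (Suc n)"]) (auto intro: less_imp_le)
  have "u \<bullet> w = f w" for w
  proof (rule ccontr)
    assume ne: "u \<bullet> w \<noteq> f w"
    define e where "e = u \<bullet> w - f w"
    have "w \<noteq> 0" using ne by auto
    then have w: "0 < w \<bullet> w" by simp
    \<comment> \<open>This is the minimiser of the quadratic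
      \<open>s * e + s\<^sup>2 * (w \<bullet> w) / 2\<close>, whose minimum is negative unless
      \<open>e = 0\<close>.\<close>
    define s where "s = - e / (w \<bullet> w)"
    have "J (u + s *\<^sub>R w) = J u + s * e + s\<^sup>2 * (w \<bullet> w) / 2"
      unfolding J_def e_def
      by (simp add: blinfun.bilinear_simps inner_simps inner_commute field_simps power2_eq_square)
    also have "s * e + s\<^sup>2 * (w \<bullet> w) / 2 = - e\<^sup>2 / (2 * (w \<bullet> w))"
      unfolding s_def using w by (simp add: field_simps power2_eq_square)
    moreover have "\<dots> < 0" using w ne by (simp add: e_def)
    ultimately show False using dle[of "u + s *\<^sub>R w"] Ju by linarith
  qed
  then have "op_A u = f" by (intro blinfun_eqI) (simp add: op_A_apply)
  then show ?thesis ..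
qed

lemma bij_op_A: "bij (op_A :: 'v::{real_inner,complete_space} \<Rightarrow> _)"
proof (rule bijI)
  show "inj (op_A :: 'v \<Rightarrow> _)"
    by (rule injI) (metis norm_op_A op_A_diff norm_eq_zero eq_iff_diff_eq_0)
  show "surj (op_A :: 'v \<Rightarrow> _)"
    by (metis riesz_representation surjI)
qed

text \<open>The reverse triangle inequality keeps half of the lower bound, hence injectivity. A
  preimage of \<open>y\<close> is a fixed point of \<open>\<lambda>x. N (y - D x)\<close>, a
  contraction with constant 1/2 because \<open>N\<close> inverts \<open>M\<close> with Lipschitz
  constant \<open>1 / c\<close>.\<close>

lemma bij_perturbation:
  fixes M D :: "'a::{real_normed_vector,complete_space} \<Rightarrow>\<^sub>L 'a"
  assumes c: "0 < c" and below: "\<And>x. c * norm x \<le> norm (M x)"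
    and surj: "surj (blinfun_apply M)" and D: "norm D \<le> c / 2"
  shows "bij (blinfun_apply (M + D))" "c / 2 * norm x \<le> norm ((M + D) x)"
proof -
  have Dx: "norm (D x) \<le> c / 2 * norm x" for x
    using norm_blinfun[of D x] mult_right_mono[OF D norm_ge_zero[of x]] by linarith
  have below': "c / 2 * norm x \<le> norm ((M + D) x)" for x
    using below[of x] Dx[of x] norm_triangle_ineq4[of "M x + D x" "D x"]
    by (simp add: blinfun.bilinear_simps)
  then show "c / 2 * norm x \<le> norm ((M + D) x)" .
  have "inj (blinfun_apply (M + D))"
  proof (rule injI)
    fix x y assume "(M + D) x = (M + D) y"
    then have "(M + D) (x - y) = 0" by (simp add: blinfun.diff_right)
    with below'[of "x - y"] have "c * norm (x - y) \<le> 0" by simp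
    then show "x = y" using c by (simp add: mult_le_0_iff)
  qed
  moreover have "surj (blinfun_apply (M + D))"
    unfolding surj_def
  proof
    fix y
    define N where "N = inv (blinfun_apply M)"
    have MN: "M (N z) = z" for z unfolding N_def using surj by (simp add: surj_f_inv_f)
    have "dist (N (y - D v)) (N (y - D w)) \<le> 1/2 * dist v w" for v w
    proof -
      have "c * norm (N (y - D v) - N (y - D w)) \<le> norm (D (w - v))"
        using below[of "N (y - D v) - N (y - D w)"] by (simp add: blinfun.diff_right MN)
      also have "\<dots> \<le> c / 2 * norm (w - v)" by (rule Dx)
      finally show ?thesis using c by (simp add: dist_norm norm_minus_commute)
    qed
    then obtain x where "N (y - D x) = x"
      using banach_fix_type[of "1/2" "\<lambda>x. N (y - D x)"] by auto
    then have "M x = y - D x" using MN by metis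
    then show "\<exists>x. y = (M + D) x" by (intro exI[of _ x]) (simp add: blinfun.add_left)
  qed
  ultimately show "bij (blinfun_apply (M + D))" by (simp add: bij_def)
qed

section \<open>Sard's theorem by counting grid points\<close>

lemma card_le_card_mult_fibres:
  assumes "finite Q" "finite G" "\<And>m. m \<in> G \<Longrightarrow> h m \<in> Q"
    and "\<And>q. card {m \<in> G. h m = q} \<le> b"
  shows "card G \<le> card Q * b"
proof -
  have "G = (\<Union>q\<in>Q. {m \<in> G. h m = q})" using assms(3) by auto
  then have "card G \<le> (\<Sum>q\<in>Q. card {m \<in> G. h m = q})"
    using card_UN_le[OF assms(1)] by metis
  also have "\<dots> \<le> card Q * b"
    using sum_bounded_above[of Q "\<lambda>q. card {m \<in> G. h m = q}" b] assms(4) by simp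
  finally show ?thesis .
qed

text \<open>Two points of \<open>P\<close> that agree off \<open>j\<close> have \<open>j\<close>-th
  coordinates less than 1 apart, because \<open>a j = 1\<close>; being integers, these are equal. So
  forgetting coordinate \<open>j\<close> is injective, and each other coordinate takes at most
  \<open>2 * w + 1\<close> values.\<close>

lemma grid_points_in_slab:
  fixes m0 :: "'i \<Rightarrow> int" and a :: "'i \<Rightarrow> real"
  assumes "finite I" "j \<in> I" "a j = 1" and P: "P \<subseteq> I \<rightarrow>\<^sub>E UNIV"
    and near: "\<And>m i. m \<in> P \<Longrightarrow> i \<in> I \<Longrightarrow> \<bar>m i - m0 i\<bar> \<le> int w"
    and slab: "\<And>m. m \<in> P \<Longrightarrow> \<bar>\<Sum>i\<in>I. a i * (of_int (m i) - of_int (m0 i))\<bar> < 1/2"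
  shows "card P \<le> (2 * w + 1) ^ (card I - 1)"
proof -
  let ?box = "(I - {j}) \<rightarrow>\<^sub>E {- int w..int w}"
  define h where "h m = (\<lambda>i\<in>I - {j}. m i - m0 i)" for m
  have "inj_on h P"
  proof (rule inj_onI)
    fix m m' assume m: "m \<in> P" and m': "m' \<in> P" and eq: "h m = h m'"
    have eq': "m i = m' i" if "i \<in> I - {j}" for i
      using fun_cong[OF eq, of i] that by (simp add: h_def)
    have split: "(\<Sum>i\<in>I. a i * (of_int (m i) - of_int (m0 i))) =
        (of_int (m j) - of_int (m0 j)) + (\<Sum>i\<in>I-{j}. a i * (of_int (m i) - of_int (m0 i)))" for m
      using sum.remove[OF assms(1,2), of "\<lambda>i. a i * (of_int (m i) - of_int (m0 i))"] assms(3) by simp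
    have same: "(\<Sum>i\<in>I-{j}. a i * (of_int (m i) - of_int (m0 i))) =
        (\<Sum>i\<in>I-{j}. a i * (of_int (m' i) - of_int (m0 i)))"
      by (rule sum.cong) (auto simp: eq')
    have "\<bar>of_int (m j) - of_int (m' j) :: real\<bar> < 1"
      using slab[OF m] slab[OF m'] unfolding split same by argo
    then have "m j = m' j" by linarith
    show "m = m'"
    proof (rule PiE_ext)
      show "m \<in> I \<rightarrow>\<^sub>E UNIV" "m' \<in> I \<rightarrow>\<^sub>E UNIV" using m m' P by auto
      show "m i = m' i" if "i \<in> I" for i using eq'[of i] \<open>m j = m' j\<close> that by blast
    qed
  qed
  moreover have "h ` P \<subseteq> ?box"
  proof
    fix y assume "y \<in> h ` P"
    then obtain m where m: "m \<in> P" "y = h m" by blast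
    have "m i - m0 i \<in> {- int w..int w}" if "i \<in> I" for i
      using near[OF m(1) that] by (simp add: abs_le_iff)
    then show "y \<in> ?box" by (simp add: m(2) h_def)
  qed
  moreover have "finite ?box" using assms(1) by (intro finite_PiE) auto
  ultimately have "card P \<le> card ?box" by (rule card_inj_on_le)
  also have "\<dots> = (2 * w + 1) ^ (card I - 1)"
    using assms(1,2) by (simp add: card_PiE nat_add_distrib nat_mult_distrib)
  finally show ?thesis .
qed

text \<open>
  Sard's theorem in equal dimensions, for the relation \<open>x u \<mapsto> f u\<close> between real vectors indexed by \<open>I\<close>.
  Near a critical point the image lies in a thin slab orthogonal to \<open>a\<close>. Among the points of
  a grid whose spacing is \<open>\<delta> / s\<close>, such a slab over a cube of side \<open>\<delta>\<close> only contains \<open>O(s ^ (card I - 1))\<close>,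
  fewer than the \<open>O(s ^ card I)\<close> that each cube has to hit on average if \<open>f\<close> covers a cube.
\<close>

lemma sard_grid:
  fixes x f :: "'u \<Rightarrow> 'i \<Rightarrow> real" and L :: nat
  assumes fin: "finite I" and \<rho>: "0 < \<rho>" and R: "0 < R"
    and bound: "\<And>u i. u \<in> U \<Longrightarrow> i \<in> I \<Longrightarrow> \<bar>x u i\<bar> \<le> R"
    and cover: "\<And>c. (\<And>i. i \<in> I \<Longrightarrow> c i \<in> {0..\<rho>}) \<Longrightarrow> \<exists>u\<in>U. \<forall>i\<in>I. f u i = c i"
    and lip: "\<And>\<delta> u u' i. 0 < \<delta> \<Longrightarrow> u \<in> U \<Longrightarrow> u' \<in> U \<Longrightarrow> (\<And>i. i \<in> I \<Longrightarrow> \<bar>x u' i - x u i\<bar> \<le> \<delta>)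
        \<Longrightarrow> i \<in> I \<Longrightarrow> \<bar>f u' i - f u i\<bar> \<le> real L * \<delta>"
    and slab: "\<And>\<epsilon>. 0 < \<epsilon> \<Longrightarrow> \<exists>\<delta>0>0. \<forall>\<delta>. 0 < \<delta> \<longrightarrow> \<delta> \<le> \<delta>0 \<longrightarrow> (\<forall>u\<in>U. \<exists>a. \<exists>j\<in>I. a j = 1 \<and>
        (\<forall>u'\<in>U. (\<forall>i\<in>I. \<bar>x u' i - x u i\<bar> \<le> \<delta>) \<longrightarrow> \<bar>\<Sum>i\<in>I. a i * (f u' i - f u i)\<bar> \<le> \<epsilon> * \<delta>))"
  shows False
proof -
  define n where "n = card I"
  obtain u0 where "u0 \<in> U" using cover[of "\<lambda>_. 0"] \<rho> by auto
  with slab[of 1] obtain j0 where "j0 \<in> I" by (meson order_refl zero_less_one)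
  then have n: "0 < n" using fin by (auto simp: n_def card_gt_0_iff)
  \<comment> \<open>The final count reduces to \<open>\<rho> ^ n * real s \<le> B\<close>. As
    \<open>B\<close> does not depend on \<open>s\<close>, a large \<open>s\<close>, fixed before
    \<open>\<delta>\<close>, contradicts it.\<close>
  define B where "B = 3 ^ n * R ^ n * (2 * real L + 1) ^ (n - 1)"
  obtain s :: nat where s: "B < \<rho> ^ n * real s" "0 < s"
  proof -
    obtain k :: nat where "B / \<rho> ^ n < real k" using reals_Archimedean2 by blast
    then have "B < \<rho> ^ n * real (Suc k)" using \<rho> by (simp add: field_simps) (smt (verit) zero_less_power)
    then show ?thesis using that by blast
  qed
  \<comment> \<open>In units of the grid spacing \<open>\<delta> / s\<close> this tolerance is 1/3,
    below the 1/2 that \<open>grid_points_in_slab\<close> requires.\<close>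
  obtain \<delta>0 where \<delta>0: "0 < \<delta>0" and slab0: "\<And>\<delta> u. 0 < \<delta> \<Longrightarrow> \<delta> \<le> \<delta>0 \<Longrightarrow> u \<in> U \<Longrightarrow> \<exists>a. \<exists>j\<in>I. a j = 1 \<and>
      (\<forall>u'\<in>U. (\<forall>i\<in>I. \<bar>x u' i - x u i\<bar> \<le> \<delta>) \<longrightarrow> \<bar>\<Sum>i\<in>I. a i * (f u' i - f u i)\<bar> \<le> 1 / (3 * real s) * \<delta>)"
    using slab[of "1 / (3 * real s)"] s(2) by (auto; blast)
  obtain N :: nat where N: "R / \<delta>0 < real N" using reals_Archimedean2 by blast
  have N0: "0 < real N" using N R \<delta>0 by (meson divide_pos_pos less_trans)
  define \<delta> where "\<delta> = R / real N"
  have \<delta>: "0 < \<delta>" "\<delta> \<le> \<delta>0" using N N0 R \<delta>0 by (auto simp: \<delta>_def field_simps)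
  define r where "r = \<delta> / real s"
  have r: "0 < r" using \<delta> s by (simp add: r_def)
  \<comment> \<open>The multiples \<open>0, r, ..., M * r\<close> are exactly those in
    \<open>{0..\<rho>}\<close>, so each coordinate has \<open>M + 1 > \<rho> / r\<close> grid
    values.\<close>
  define M where "M = nat \<lfloor>\<rho> / r\<rfloor>"
  have M: "real M * r \<le> \<rho>" "\<rho> / r < real M + 1"
  proof -
    have "real M \<le> \<rho> / r" unfolding M_def using \<rho> r by (simp add: of_nat_nat)
    then show "real M * r \<le> \<rho>" using r by (simp add: field_simps)
    show "\<rho> / r < real M + 1" unfolding M_def using \<rho> r by linarith
  qed
  define G where "G = I \<rightarrow>\<^sub>E {0..int M}"
  have "\<exists>u\<in>U. \<forall>i\<in>I. f u i = r * of_int (m i)" if "m \<in> G" for m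
  proof (rule cover)
    fix i assume "i \<in> I"
    then have "m i \<in> {0..int M}" using that by (auto simp: G_def)
    then have "0 \<le> (of_int (m i) :: real)" "(of_int (m i) :: real) \<le> real M" by auto
    moreover from this have "r * of_int (m i) \<le> r * real M" using r by (intro mult_left_mono) auto
    moreover have "r * real M \<le> \<rho>" using M(1) by (simp add: mult.commute)
    moreover from calculation have "0 \<le> r * of_int (m i)" using r by (intro mult_nonneg_nonneg) auto
    ultimately show "r * of_int (m i) \<in> {0..\<rho>}" unfolding atLeastAtMost_iff by linarith
  qed
  then obtain v where vU: "\<And>m. m \<in> G \<Longrightarrow> v m \<in> U"
    and fv: "\<And>m i. m \<in> G \<Longrightarrow> i \<in> I \<Longrightarrow> f (v m) i = r * of_int (m i)" by metis
  \<comment> \<open>This is the index of the cube of side \<open>\<delta>\<close> that contains the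
    point. Since \<open>R / \<delta> = N\<close>, the indices run over \<open>2 * N + 1\<close>
    values; the top one, \<open>N\<close>, is there for coordinates equal to
    \<open>R\<close>.\<close>
  define cell where "cell m = (\<lambda>i\<in>I. \<lfloor>x (v m) i / \<delta>\<rfloor>)" for m
  define Q where "Q = I \<rightarrow>\<^sub>E {- int N..int N}"
  have finG: "finite G" and finQ: "finite Q" unfolding G_def Q_def using fin by (auto intro: finite_PiE)
  have cellQ: "cell m \<in> Q" if "m \<in> G" for m
    unfolding Q_def cell_def
  proof (rule restrict_PiE_iff[THEN iffD2], intro ballI)
    fix i assume "i \<in> I"
    then have "\<bar>x (v m) i / \<delta>\<bar> \<le> real N"
      using bound[OF vU[OF that]] \<delta> N0 R by (simp add: \<delta>_def abs_mult field_simps)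
    from abs_le_D1[OF this] abs_le_D2[OF this] show "\<lfloor>x (v m) i / \<delta>\<rfloor> \<in> {- int N..int N}"
      unfolding atLeastAtMost_iff by linarith
  qed
  \<comment> \<open>Points of one cell are \<open>\<delta>\<close>-close, so their values differ by
    at most \<open>L * \<delta>\<close>, that is \<open>L * s\<close> grid steps, and they lie in a
    common slab.\<close>
  have fibre: "card {m \<in> G. cell m = q} \<le> (2 * (L * s) + 1) ^ (n - 1)" for q
  proof (cases "{m \<in> G. cell m = q} = {}")
    case False
    then obtain m0 where m0: "m0 \<in> G" "cell m0 = q" by auto
    obtain a j where j: "j \<in> I" "a j = 1" and a: "\<And>u'. u' \<in> U \<Longrightarrow> (\<forall>i\<in>I. \<bar>x u' i - x (v m0) i\<bar> \<le> \<delta>) \<Longrightarrow>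
        \<bar>\<Sum>i\<in>I. a i * (f u' i - f (v m0) i)\<bar> \<le> 1 / (3 * real s) * \<delta>"
      using slab0[OF \<delta> vU[OF m0(1)]] by blast
    have close: "\<bar>x (v m) i - x (v m0) i\<bar> \<le> \<delta>" if "m \<in> G" "cell m = q" "i \<in> I" for m i
    proof -
      have "cell m i = cell m0 i" using that m0 by simp
      then have "\<lfloor>x (v m) i / \<delta>\<rfloor> = \<lfloor>x (v m0) i / \<delta>\<rfloor>" using that(3) by (simp add: cell_def)
      then have "\<bar>x (v m) i / \<delta> - x (v m0) i / \<delta>\<bar> \<le> 1" by linarith
      then show ?thesis using \<delta> by (simp add: diff_divide_distrib[symmetric] field_simps)
    qed
    show ?thesis unfolding n_def
    proof (rule grid_points_in_slab[where a = a and j = j and ?m0.0 = m0])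
      fix m assume "m \<in> {m \<in> G. cell m = q}"
      then have m: "m \<in> G" "cell m = q" by auto
      show "\<bar>m i - m0 i\<bar> \<le> int (L * s)" if "i \<in> I" for i
      proof -
        have "\<bar>f (v m) i - f (v m0) i\<bar> \<le> real L * \<delta>"
          using lip[OF \<delta>(1) vU[OF m0(1)] vU[OF m(1)] close[OF m]] that by blast
        moreover have "f (v m) i - f (v m0) i = r * (of_int (m i) - of_int (m0 i))"
          using that m m0 by (simp add: fv right_diff_distrib)
        moreover have "real L * \<delta> = r * (real L * real s)" using s by (simp add: r_def)
        ultimately have "r * \<bar>of_int (m i) - of_int (m0 i)\<bar> \<le> r * (real L * real s)"
          using r by (simp add: abs_mult)
        then have "\<bar>of_int (m i) - of_int (m0 i)\<bar> \<le> real L * real s" using r by simp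
        then have "of_int \<bar>m i - m0 i\<bar> \<le> (of_int (int (L * s)) :: real)" by simp
        then show ?thesis by (simp only: of_int_le_iff)
      qed
      have "\<bar>\<Sum>i\<in>I. a i * (f (v m) i - f (v m0) i)\<bar> \<le> 1 / (3 * real s) * \<delta>"
        using a[OF vU[OF m(1)]] close[OF m] by blast
      also have "(\<Sum>i\<in>I. a i * (f (v m) i - f (v m0) i)) = r * (\<Sum>i\<in>I. a i * (of_int (m i) - of_int (m0 i)))"
        unfolding sum_distrib_left using m m0 by (intro sum.cong) (auto simp: fv algebra_simps)
      also have "1 / (3 * real s) * \<delta> = r * (1/3)" by (simp add: r_def)
      finally have "r * \<bar>\<Sum>i\<in>I. a i * (of_int (m i) - of_int (m0 i))\<bar> \<le> r * (1/3)"
        using r by (simp add: abs_mult)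
      then show "\<bar>\<Sum>i\<in>I. a i * (of_int (m i) - of_int (m0 i))\<bar> < 1/2" using r by simp
    qed (use fin j G_def in auto)
  next
    case True
    then show ?thesis by (simp only: card.empty)
  qed
  have "card G \<le> card Q * (2 * (L * s) + 1) ^ (n - 1)"
    using card_le_card_mult_fibres[OF finQ finG cellQ fibre] .
  then have "(M + 1) ^ n \<le> (2 * N + 1) ^ n * (2 * (L * s) + 1) ^ (n - 1)"
    unfolding G_def Q_def using fin by (simp add: card_PiE n_def nat_add_distrib nat_mult_distrib)
  then have "real ((M + 1) ^ n) \<le> real ((2 * N + 1) ^ n * (2 * (L * s) + 1) ^ (n - 1))"
    by (simp only: of_nat_le_iff)
  then have le1: "(real M + 1) ^ n \<le> (2 * real N + 1) ^ n * (2 * (real L * real s) + 1) ^ (n - 1)"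
    by (simp add: add_ac)
  \<comment> \<open>The left side is \<open>(\<rho> / r) ^ n\<close>. The estimates
    \<open>2 * N + 1 \<le> 3 * N\<close> and \<open>2 * L * s + 1 \<le> (2 * L + 1) * s\<close> let
    the powers of \<open>N\<close> cancel and leave one spare factor \<open>s\<close> on the
    left.\<close>
  have "(\<rho> * real s * real N / R) ^ n \<le> (real M + 1) ^ n"
    using M(2) \<rho> R N0 s by (intro power_mono) (auto simp: r_def \<delta>_def field_simps)
  also note le1
  also have "(2 * real N + 1) ^ n * (2 * (real L * real s) + 1) ^ (n - 1) \<le>
      (3 * real N) ^ n * ((2 * real L + 1) * real s) ^ (n - 1)"
    using N0 s(2) by (intro mult_mono power_mono) (auto simp: algebra_simps)
  finally have "\<rho> ^ n * real s ^ n * real N ^ n / R ^ n \<le> 3 ^ n * real N ^ n * ((2 * real L + 1) ^ (n - 1) * real s ^ (n - 1))"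
    by (simp only: power_divide power_mult_distrib)
  then have "\<rho> ^ n * real s ^ n * real N ^ n \<le> 3 ^ n * real N ^ n * ((2 * real L + 1) ^ (n - 1) * real s ^ (n - 1)) * R ^ n"
    using R by (simp only: pos_divide_le_eq zero_less_power)
  then have "(\<rho> ^ n * real s ^ n) * real N ^ n \<le> (B * real s ^ (n - 1)) * real N ^ n"
    by (simp add: B_def mult_ac)
  then have "\<rho> ^ n * real s ^ n \<le> B * real s ^ (n - 1)" using N0 by simp
  moreover have "real s ^ n = real s * real s ^ (n - 1)" using n by (simp add: power_eq_if)
  ultimately have "(\<rho> ^ n * real s) * real s ^ (n - 1) \<le> B * real s ^ (n - 1)" by (simp add: mult_ac)
  then have "\<rho> ^ n * real s \<le> B" using s(2) by simp
  then show False using s(1) by simp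
qed

section \<open>Finite-dimensional subspaces of an inner product space\<close>

definition orthonormal :: "'v::real_inner set \<Rightarrow> bool" where
  "orthonormal C \<longleftrightarrow> finite C \<and> (\<forall>c\<in>C. \<forall>d\<in>C. c \<bullet> d = (if c = d then 1 else 0))"

text \<open>For orthonormal \<open>C\<close> this is the orthogonal projection onto
  \<open>span C\<close>, packaged as a bounded operator so that it composes with
  derivatives.\<close>

definition orth_proj :: "'v::real_inner set \<Rightarrow> 'v \<Rightarrow>\<^sub>L 'v" where
  "orth_proj C = Blinfun (\<lambda>v. \<Sum>c\<in>C. (v \<bullet> c) *\<^sub>R c)"

lemma orth_proj_apply: "orth_proj C v = (\<Sum>c\<in>C. (v \<bullet> c) *\<^sub>R c)"
  unfolding orth_proj_def
  by (subst bounded_linear_Blinfun_apply)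
    (auto intro!: bounded_linear_sum bounded_linear_compose[OF bounded_linear_scaleR_left]
      bounded_linear_inner_left)

lemma proj_in_span: "orth_proj C v \<in> span C"
  by (auto simp: orth_proj_apply intro: span_sum span_scale span_base)

context
  fixes C :: "'v::real_inner set"
  assumes C: "orthonormal C"
begin

lemma inner_proj_member: "c \<in> C \<Longrightarrow> orth_proj C v \<bullet> c = v \<bullet> c"
proof -
  assume c: "c \<in> C"
  have "orth_proj C v \<bullet> c = (\<Sum>d\<in>C. (v \<bullet> d) * (if d = c then 1 else 0))"
    unfolding orth_proj_apply inner_sum_left using C c by (intro sum.cong) (auto simp: orthonormal_def)
  also have "\<dots> = (\<Sum>d\<in>C. if d = c then v \<bullet> d else 0)" by (intro sum.cong) auto
  also have "\<dots> = v \<bullet> c"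
    using C c by (simp add: orthonormal_def)
  finally show ?thesis .
qed

lemma inner_proj_span: "a \<in> span C \<Longrightarrow> a \<bullet> orth_proj C v = a \<bullet> v"
proof (induction rule: span_induct)
  case base
  show ?case by (auto simp: subspace_def inner_simps)
next
  case (step x)
  then show ?case using inner_proj_member[of x v] by (simp add: inner_commute)
qed

lemma proj_id_span: "a \<in> span C \<Longrightarrow> orth_proj C a = a"
proof -
  assume a: "a \<in> span C"
  then have d: "orth_proj C a - a \<in> span C" by (intro span_diff proj_in_span)
  have "(orth_proj C a - a) \<bullet> (orth_proj C a - a) = 0"
    using inner_proj_span[OF d, of a] by (simp add: inner_diff_right)
  then show ?thesis by simp
qed

text \<open>The residual is orthogonal to the projection, so its squared norm is its inner product
  with \<open>v\<close>, and Cauchy-Schwarz applies.\<close>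

lemma norm_diff_proj: "norm (v - orth_proj C v) \<le> norm v"
proof -
  have "orth_proj C v \<bullet> (v - orth_proj C v) = 0"
    using inner_proj_span[OF proj_in_span, of v v] by (simp add: inner_diff_right)
  then have "(v - orth_proj C v) \<bullet> (v - orth_proj C v) = v \<bullet> (v - orth_proj C v)"
    by (simp add: inner_diff_left)
  then have "norm (v - orth_proj C v) * norm (v - orth_proj C v) \<le> norm v * norm (v - orth_proj C v)"
    using norm_cauchy_schwarz[of v "v - orth_proj C v"] by (simp add: dot_square_norm power2_eq_square)
  then show ?thesis by (cases "v - orth_proj C v = 0") auto
qed

lemma orthonormal_finite: "finite C" using C by (simp add: orthonormal_def)

lemma orthonormal_norm: "c \<in> C \<Longrightarrow> norm c = 1"
  using C by (simp add: orthonormal_def norm_eq_1)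

lemma orthonormal_expand: "a \<in> span C \<Longrightarrow> a = (\<Sum>c\<in>C. (a \<bullet> c) *\<^sub>R c)"
  using proj_id_span[of a] by (simp add: orth_proj_apply)

lemma orthonormal_inner_expand: "a \<in> span C \<Longrightarrow> a \<bullet> z = (\<Sum>c\<in>C. (a \<bullet> c) * (z \<bullet> c))"
proof -
  assume "a \<in> span C"
  then have "a \<bullet> z = (\<Sum>c\<in>C. (a \<bullet> c) *\<^sub>R c) \<bullet> z" using orthonormal_expand by metis
  then show ?thesis by (simp add: inner_sum_left inner_commute[of z])
qed

lemma orthonormal_independent: "independent C"
proof (rule pairwise_orthogonal_independent)
  show "pairwise orthogonal C" using C by (auto simp: orthonormal_def pairwise_def orthogonal_def)
  show "0 \<notin> C" using C by (force simp: orthonormal_def)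
qed

lemma norm_le_coord_sum:
  assumes "a \<in> span C" "\<And>c. c \<in> C \<Longrightarrow> \<bar>a \<bullet> c\<bar> \<le> b"
  shows "norm a \<le> real (card C) * b"
proof -
  have "norm a = norm (\<Sum>c\<in>C. (a \<bullet> c) *\<^sub>R c)" using orthonormal_expand[OF assms(1)] by simp
  also have "\<dots> \<le> (\<Sum>c\<in>C. b)"
    using assms(2) by (intro sum_norm_le) (simp add: orthonormal_norm)
  finally show ?thesis by simp
qed

end

lemma orthonormal_basis_exists:
  assumes "finite (B :: 'v::real_inner set)"
  obtains C where "orthonormal C" "span C = span B"
proof -
  obtain C where C: "finite C" "span C = span B" "pairwise orthogonal C"
    using basis_orthogonal[OF assms] by blast
  define D where "D = (\<lambda>c. c /\<^sub>R norm c) ` (C - {0})"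
  have "orthonormal D"
    unfolding orthonormal_def
  proof (intro conjI ballI)
    show "finite D" using C(1) by (simp add: D_def)
    fix x y assume "x \<in> D" "y \<in> D"
    then obtain c d where c: "c \<in> C" "c \<noteq> 0" "x = c /\<^sub>R norm c" and d: "d \<in> C" "d \<noteq> 0" "y = d /\<^sub>R norm d"
      by (auto simp: D_def)
    show "x \<bullet> y = (if x = y then 1 else 0)"
    proof (cases "c = d")
      case True
      then show ?thesis using c d by (simp add: dot_square_norm power2_eq_square)
    next
      case False
      then have "c \<bullet> d = 0" using C(3) c(1) d(1) by (auto simp: pairwise_def orthogonal_def)
      then have "x \<bullet> y = 0" using c d by simp
      moreover have "x \<bullet> x \<noteq> 0" using c by simp
      ultimately show ?thesis by auto
    qed
  qed
  moreover have "span D = span C"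
  proof
    show "span D \<subseteq> span C"
      by (rule span_minimal) (auto simp: D_def intro: span_scale span_base)
    have "c \<in> span D" if "c \<in> C" for c
    proof (cases "c = 0")
      case False
      then have "norm c *\<^sub>R (c /\<^sub>R norm c) \<in> span D"
        using that by (intro span_scale span_base) (auto simp: D_def)
      then show ?thesis using False by simp
    qed (simp add: span_zero)
    then show "span C \<subseteq> span D" by (intro span_minimal) auto
  qed
  ultimately show ?thesis using that C(2) by simp
qed

text \<open>The image of \<open>C\<close> spans \<open>C\<close>, so by the exchange bound it has no
  fewer elements than \<open>C\<close> and none of them is redundant. Hence it is independent and
  \<open>\<Phi>\<close> is injective on \<open>C\<close>.\<close>

lemma linear_surj_on_span_imp_inj_on:
  fixes \<Phi> :: "'v::real_vector \<Rightarrow> 'v"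
  assumes "linear \<Phi>" "finite C" "independent C" "span C \<subseteq> \<Phi> ` span C"
  shows "inj_on \<Phi> (span C)"
proof -
  have sub: "C \<subseteq> span (\<Phi> ` C)"
    using assms(4) span_superset[of C] by (auto simp: linear_span_image[OF assms(1)])
  have "card C \<le> card (\<Phi> ` C)"
    using independent_span_bound[OF _ assms(3) sub] assms(2) by simp
  then have "inj_on \<Phi> C" using assms(2) by (simp add: card_image_le eq_card_imp_inj_on le_antisym)
  moreover have "independent (\<Phi> ` C)"
  proof
    assume "dependent (\<Phi> ` C)"
    then obtain b where b: "b \<in> \<Phi> ` C" "b \<in> span (\<Phi> ` C - {b})" by (auto simp: dependent_def)
    then have "span (\<Phi> ` C) = span (\<Phi> ` C - {b})" by (metis insert_Diff span_redundant)
    then have "card C \<le> card (\<Phi> ` C - {b})"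
      using independent_span_bound[OF _ assms(3), of "\<Phi> ` C - {b}"] sub assms(2) by simp
    also have "\<dots> < card (\<Phi> ` C)" using b assms(2) by (intro psubset_card_mono) auto
    also have "\<dots> \<le> card C" using assms(2) by (rule card_image_le)
    finally show False by simp
  qed
  ultimately show ?thesis by (simp add: linear_inj_on_span_iff_independent_image[OF assms(1)])
qed

text \<open>Factor \<open>M + k\<close> as \<open>\<Phi>\<close> after \<open>M\<close>, where
  \<open>\<Phi>\<close> is the identity plus \<open>k\<close> after the inverse of \<open>M\<close>
  and maps \<open>span C\<close> into itself. If \<open>M + k\<close> is not bijective,
  \<open>\<Phi>\<close> is not onto \<open>span C\<close>, and \<open>a\<close> is taken orthogonal
  to its range there.\<close>

lemma left_null_vector:
  fixes M k :: "'v::real_inner \<Rightarrow>\<^sub>L 'v"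
  assumes C: "orthonormal C" and M: "bij (blinfun_apply M)"
    and k: "\<And>v. k v \<in> span C" and nbij: "\<not> bij (blinfun_apply (M + k))"
  obtains a where "a \<in> span C" "a \<noteq> 0" "\<And>v. M v \<in> span C \<Longrightarrow> a \<bullet> M v = - (a \<bullet> k v)"
proof -
  define N where "N = inv (blinfun_apply M)"
  have MN: "M (N z) = z" for z unfolding N_def using M by (simp add: bij_is_surj surj_f_inv_f)
  have NM: "N (M z) = z" for z unfolding N_def using M by (simp add: bij_is_inj)
  have linN: "linear N"
    by (rule linearI) (metis MN NM blinfun.add_right, metis MN NM blinfun.scaleR_right)
  define \<Phi> where "\<Phi> z = z + k (N z)" for z
  have lin: "linear \<Phi>"
    unfolding \<Phi>_def using linN
    by (intro linearI) (simp_all add: linear_add linear_scale blinfun.add_right blinfun.scaleR_right scaleR_add_right)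
  have into: "\<Phi> ` span C \<subseteq> span C" unfolding \<Phi>_def using k by (auto intro: span_add)
  have "\<not> span C \<subseteq> \<Phi> ` span C"
  proof
    assume surj: "span C \<subseteq> \<Phi> ` span C"
    then have inj: "inj_on \<Phi> (span C)"
      by (intro linear_surj_on_span_imp_inj_on[OF lin orthonormal_finite[OF C] orthonormal_independent[OF C]])
    have "inj (blinfun_apply (M + k))"
    proof (rule injI)
      fix x y assume eq: "(M + k) x = (M + k) y"
      define v where "v = x - y"
      have v: "M v = - k v" using eq by (simp add: v_def blinfun.bilinear_simps algebra_simps)
      then have "M v \<in> span C" using k by (simp add: span_neg)
      moreover have "\<Phi> (M v) = M v + k v" by (simp add: \<Phi>_def NM)
      then have "\<Phi> (M v) = \<Phi> 0" using v by (simp add: \<Phi>_def linear_0[OF linN])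
      ultimately have "M v = 0" using inj by (auto dest: inj_onD simp: span_zero)
      then have "v = 0" using NM[of v] linear_0[OF linN] by simp
      then show "x = y" by (simp add: v_def)
    qed
    moreover have "surj (blinfun_apply (M + k))"
      unfolding surj_def
    proof
      fix y
      \<comment> \<open>\<open>N y\<close> solves the equation up to the error
        \<open>k (N y)\<close> in \<open>span C\<close>; solving for \<open>z\<close> there gives
        the exact solution \<open>N (y - z)\<close>.\<close>
      obtain z where z: "z \<in> span C" "\<Phi> z = k (N y)" using surj k[of "N y"] by (metis imageE subsetD)
      have "(M + k) (N (y - z)) = y - z + (k (N y) - k (N z))"
        by (simp add: blinfun.add_left MN linear_diff[OF linN] blinfun.diff_right)
      also have "\<dots> = y" using z(2) by (simp add: \<Phi>_def algebra_simps)
      finally show "\<exists>x. y = (M + k) x" by metis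
    qed
    ultimately show False using nbij by (simp add: bij_def)
  qed
  then obtain w where w: "w \<in> span C" "w \<notin> \<Phi> ` span C" by blast
  obtain D where D: "orthonormal D" "span D = span (\<Phi> ` C)"
    using orthonormal_basis_exists[of "\<Phi> ` C"] orthonormal_finite[OF C] by auto
  have spD: "span D = \<Phi> ` span C" by (simp add: D(2) linear_span_image[OF lin])
  define a where "a = w - orth_proj D w"
  show ?thesis
  proof (rule that)
    have "orth_proj D w \<in> span C" using proj_in_span[of D w] spD into by blast
    then show "a \<in> span C" unfolding a_def using w by (intro span_diff) auto
    show "a \<noteq> 0" using w proj_in_span[of D w] spD by (auto simp: a_def)
    fix v assume v: "M v \<in> span C"
    then have "\<Phi> (M v) \<in> span D" using spD by blast
    then have "\<Phi> (M v) \<bullet> a = 0" using inner_proj_span[OF D(1)] by (simp add: a_def inner_diff_right)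
    then show "a \<bullet> M v = - (a \<bullet> k v)"
      by (simp add: \<Phi>_def NM inner_commute inner_add_right eq_neg_iff_add_eq_0)
  qed
qed

section \<open>Compact boxes and finite unions of nowhere dense closed sets\<close>

lemma compact_coordinate_box:
  fixes C :: "'v::real_normed_vector set"
  assumes "finite C"
  shows "compact {\<Sum>c\<in>C. x c *\<^sub>R c | x. \<forall>c\<in>C. \<bar>x c\<bar> \<le> (R::real)}"
  using assms
proof (induction C)
  case (insert d C)
  have "{\<Sum>c\<in>insert d C. x c *\<^sub>R c | x. \<forall>c\<in>insert d C. \<bar>x c\<bar> \<le> R} =
      {v + w | v w. v \<in> (\<lambda>s. s *\<^sub>R d) ` {-R..R} \<and> w \<in> {\<Sum>c\<in>C. x c *\<^sub>R c | x. \<forall>c\<in>C. \<bar>x c\<bar> \<le> R}}"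
    (is "?l = ?r")
  proof
    show "?l \<subseteq> ?r" using insert.hyps by (fastforce simp: abs_le_iff)
    show "?r \<subseteq> ?l"
    proof
      fix z assume "z \<in> ?r"
      then obtain s x where s: "s \<in> {-R..R}" and x: "\<forall>c\<in>C. \<bar>x c\<bar> \<le> R"
        and z: "z = s *\<^sub>R d + (\<Sum>c\<in>C. x c *\<^sub>R c)" by blast
      have "(\<Sum>c\<in>C. (x(d := s)) c *\<^sub>R c) = (\<Sum>c\<in>C. x c *\<^sub>R c)"
        using insert.hyps(2) by (intro sum.cong) auto
      then have "z = (\<Sum>c\<in>insert d C. (x(d := s)) c *\<^sub>R c)" using z insert.hyps by simp
      moreover have "\<forall>c\<in>insert d C. \<bar>(x(d := s)) c\<bar> \<le> R" using s x by (auto simp: abs_le_iff)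
      ultimately show "z \<in> ?l" by blast
    qed
  qed
  moreover have "compact ?r"
    by (intro compact_sums insert.IH compact_continuous_image continuous_intros compact_Icc)
  ultimately show ?case by simp
qed simp

text \<open>A finite form of Baire's theorem: removing one closed set from a ball leaves a smaller
  ball, in which the induction continues.\<close>

lemma finite_nowhere_dense_union:
  assumes "finite \<A>" "\<And>A. A \<in> \<A> \<Longrightarrow> closed A" "\<And>A y \<rho>. A \<in> \<A> \<Longrightarrow> 0 < \<rho> \<Longrightarrow> \<not> ball y \<rho> \<subseteq> A"
    and "0 < \<rho>"
  shows "\<not> ball (y::'a::metric_space) \<rho> \<subseteq> \<Union>\<A>"
  using assms
proof (induction \<A> arbitrary: y \<rho>)
  case (insert A \<A>)
  have "\<not> ball y \<rho> \<subseteq> A" using insert.prems by blast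
  moreover have "open (ball y \<rho> - A)" using insert.prems by (intro open_Diff) auto
  ultimately obtain z e where z: "0 < e" "ball z e \<subseteq> ball y \<rho> - A"
    by (metis DiffI open_contains_ball subsetI)
  have "\<not> ball z e \<subseteq> \<Union>\<A>" using insert.prems z(1) by (intro insert.IH) auto
  then show ?case using z(2) by blast
qed auto

section \<open>Compact perturbations of the identity\<close>

text \<open>The setting after composition with the inverse Riesz isometry. The assumption
  \<open>coercive\<close> is weak coercivity, stated as boundedness of preimages of bounded
  sets.\<close>

locale compact_perturbation =
  fixes g :: "'v::{real_inner,complete_space} \<Rightarrow> 'v" and g' :: "'v \<Rightarrow> 'v \<Rightarrow>\<^sub>L 'v"
  assumes deriv: "(g has_derivative blinfun_apply (g' u)) (at u)"
    and cont: "continuous_on UNIV g'"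
    and cpt: "bounded S \<Longrightarrow> compact (closure (g ` S))"
    and coercive: "bounded S \<Longrightarrow> bounded {u. u + g u \<in> S}"
begin

definition t :: "'v \<Rightarrow> 'v" where "t u = u + g u"

definition t' :: "'v \<Rightarrow> 'v \<Rightarrow>\<^sub>L 'v" where "t' u = id_blinfun + g' u"

definition crit :: "'v set" where "crit = {u. \<not> bij (blinfun_apply (t' u))}"

lemma t'_apply: "t' u x = x + g' u x"
  by (simp add: t'_def blinfun.add_left)

section \<open>Continuity and properness of \<open>t\<close>\<close>

lemma tendsto_g: "X \<longlonglongrightarrow> l \<Longrightarrow> (\<lambda>n. g (X n)) \<longlonglongrightarrow> g l"
  by (rule isCont_tendsto_compose[OF has_derivative_continuous[OF deriv]])

lemma tendsto_g': "X \<longlonglongrightarrow> l \<Longrightarrow> (\<lambda>n. g' (X n)) \<longlonglongrightarrow> g' l"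
  using cont by (intro isCont_tendsto_compose[of l g']) (simp_all add: continuous_on_eq_continuous_at)

text \<open>Coercivity bounds the sequence, compactness makes \<open>g\<close> converge along a
  subsequence, and then \<open>X = t X - g X\<close> converges as well.\<close>

lemma proper_subsequence:
  assumes lim: "(\<lambda>n. t (X n)) \<longlonglongrightarrow> y"
  obtains l r where "strict_mono (r :: nat \<Rightarrow> nat)" "(X \<circ> r) \<longlonglongrightarrow> l" "t l = y"
proof -
  have "bounded {u. u + g u \<in> range (\<lambda>n. t (X n))}"
    by (intro coercive convergent_imp_bounded[OF lim])
  then have "compact (closure (g ` {u. u + g u \<in> range (\<lambda>n. t (X n))}))" by (rule cpt)
  moreover have "g (X n) \<in> closure (g ` {u. u + g u \<in> range (\<lambda>n. t (X n))})" for n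
    by (intro subsetD[OF closure_subset] imageI) (simp add: t_def)
  ultimately obtain z r where r: "strict_mono r" "((\<lambda>n. g (X n)) \<circ> r) \<longlonglongrightarrow> z"
    unfolding compact_def by meson
  have tr: "(\<lambda>n. t (X (r n))) \<longlonglongrightarrow> y"
    using LIMSEQ_subseq_LIMSEQ[OF lim r(1)] by (simp add: o_def)
  then have "(\<lambda>n. t (X (r n)) - g (X (r n))) \<longlonglongrightarrow> y - z"
    using r(2) by (intro tendsto_diff) (auto simp: o_def)
  then have Xr: "(\<lambda>n. X (r n)) \<longlonglongrightarrow> y - z" by (simp add: t_def)
  then have "(\<lambda>n. t (X (r n))) \<longlonglongrightarrow> t (y - z)"
    unfolding t_def by (intro tendsto_add tendsto_g)
  then have "t (y - z) = y" using tr LIMSEQ_unique by blast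
  then show ?thesis using that[of r "y - z"] r(1) Xr by (simp add: o_def)
qed

lemma compact_preimage: "compact (t -` Q)" if Q: "compact Q"
  unfolding compact_def
proof (intro allI impI)
  fix X :: "nat \<Rightarrow> 'v" assume X: "\<forall>n. X n \<in> t -` Q"
  then have "\<forall>n. t (X n) \<in> Q" by simp
  then obtain y r where r: "y \<in> Q" "strict_mono r" "((\<lambda>n. t (X n)) \<circ> r) \<longlonglongrightarrow> y"
    using Q[unfolded compact_def, THEN spec[of _ "\<lambda>n. t (X n)"]] by auto
  then have "(\<lambda>n. t ((X \<circ> r) n)) \<longlonglongrightarrow> y" by (simp add: o_def)
  then obtain l q where "strict_mono q" "((X \<circ> r) \<circ> q) \<longlonglongrightarrow> l" "t l = y"
    by (rule proper_subsequence)
  then show "\<exists>l\<in>t -` Q. \<exists>r. strict_mono r \<and> (X \<circ> r) \<longlonglongrightarrow> l"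
    using r by (intro bexI[of _ l] exI[of _ "r \<circ> q"] conjI strict_mono_o) (simp_all add: o_assoc)
qed

lemma closed_image: "closed (t ` S)" if "closed S"
  unfolding closed_sequential_limits
proof (intro allI impI)
  fix Y y assume "(\<forall>n. Y n \<in> t ` S) \<and> Y \<longlonglongrightarrow> y"
  then have Y: "Y \<longlonglongrightarrow> y" and "\<forall>n. \<exists>x. x \<in> S \<and> Y n = t x" by auto
  then obtain X where X: "\<And>n. X n \<in> S" "\<And>n. Y n = t (X n)" by metis
  have "(\<lambda>n. t (X n)) \<longlonglongrightarrow> y" using Y unfolding X(2)[symmetric] by simp
  then obtain l r where "strict_mono (r :: nat \<Rightarrow> nat)" and l: "(X \<circ> r) \<longlonglongrightarrow> l" "t l = y"
    by (rule proper_subsequence)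
  have "l \<in> S" using closed_sequentially[OF that _ l(1)] X by simp
  then show "y \<in> t ` S" using l by blast
qed

section \<open>Compactness of the derivative and its consequences\<close>

text \<open>Difference quotients of one fixed step \<open>s\<close> approximate \<open>g' u\<close>
  uniformly on the unit ball. A finite net for the image of \<open>cball u s\<close> under
  \<open>g\<close>, shifted by \<open>g u\<close> and divided by \<open>s\<close>, is therefore a
  net for the image under \<open>g' u\<close>.\<close>

lemma derivative_totally_bounded:
  assumes "0 < e"
  obtains F where "finite F" "g' u ` cball 0 1 \<subseteq> (\<Union>x\<in>F. ball x e)"
proof -
  obtain d where d: "0 < d" and lin: "\<And>y. norm (y - u) < d \<Longrightarrow>
      norm (g y - g u - g' u (y - u)) \<le> e / 4 * norm (y - u)"
    using deriv[of u] assms unfolding has_derivative_at_alt by (meson divide_pos_pos zero_less_numeral)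
  define s where "s = d / 2"
  have s: "0 < s" "s < d" using d by (auto simp: s_def)
  have "compact (closure (g ` cball u s))" by (intro cpt bounded_cball)
  then obtain F where F: "finite F" "closure (g ` cball u s) \<subseteq> (\<Union>x\<in>F. ball x (e * s / 4))"
    using assms s(1) unfolding compact_eq_totally_bounded
    by (metis divide_pos_pos mult_pos_pos zero_less_numeral)
  have "g' u ` cball 0 1 \<subseteq> (\<Union>x\<in>(\<lambda>z. (z - g u) /\<^sub>R s) ` F. ball x e)"
  proof
    fix y assume "y \<in> g' u ` cball 0 1"
    then obtain h where h: "norm h \<le> 1" "y = g' u h" by auto
    have hs: "norm (s *\<^sub>R h) \<le> s" using h s by (simp add: mult_left_le)
    then have "g (u + s *\<^sub>R h) \<in> closure (g ` cball u s)"
      by (intro subsetD[OF closure_subset] imageI) (simp add: dist_norm)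
    then obtain z where z: "z \<in> F" "norm (z - g (u + s *\<^sub>R h)) < e * s / 4"
      using F(2) by (auto simp: dist_norm)
    have "norm (s *\<^sub>R h) < d" using hs s by linarith
    then have "norm (g (u + s *\<^sub>R h) - g u - s *\<^sub>R y) \<le> e / 4 * norm (s *\<^sub>R h)"
      using lin[of "u + s *\<^sub>R h"] by (simp add: h(2) blinfun.scaleR_right)
    also have "\<dots> \<le> e / 4 * s" using hs assms by (intro mult_left_mono) auto
    finally have "norm ((z - g (u + s *\<^sub>R h)) + (g (u + s *\<^sub>R h) - g u - s *\<^sub>R y)) < e * s / 4 + e * s / 4"
      using z(2) by (intro norm_triangle_lt) (simp add: field_simps)
    also have "(z - g (u + s *\<^sub>R h)) + (g (u + s *\<^sub>R h) - g u - s *\<^sub>R y) = z - g u - s *\<^sub>R y" by simp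
    finally have "norm (z - g u - s *\<^sub>R y) < e * s / 4 + e * s / 4" .
    moreover have "0 < s * e" using assms s by simp
    ultimately have "norm (z - g u - s *\<^sub>R y) < s * e" by (simp add: mult.commute)
    moreover have "s * norm ((z - g u) /\<^sub>R s - y) = norm (z - g u - s *\<^sub>R y)"
    proof -
      have "z - g u - s *\<^sub>R y = s *\<^sub>R ((z - g u) /\<^sub>R s - y)" using s by (simp add: scaleR_diff_right)
      then show ?thesis using s by simp
    qed
    ultimately have "norm ((z - g u) /\<^sub>R s - y) < e" using s by (metis mult_less_cancel_left_pos)
    then show "y \<in> (\<Union>x\<in>(\<lambda>z. (z - g u) /\<^sub>R s) ` F. ball x e)"
      using z(1) by (auto simp: dist_norm)
  qed
  then show ?thesis using that F(1) by blast
qed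

lemma compact_derivative: "compact (closure (g' u ` cball 0 1))"
  unfolding compact_eq_totally_bounded
proof (intro conjI allI impI)
  show "complete (closure (g' u ` cball 0 1))" by (simp add: complete_eq_closed)
  fix e :: real assume e: "0 < e"
  \<comment> \<open>Halving the radius leaves room to pass to closed balls when the closure is
    taken.\<close>
  obtain F where F: "finite F" "g' u ` cball 0 1 \<subseteq> (\<Union>x\<in>F. ball x (e/2))"
    using derivative_totally_bounded[of "e/2" u] e by auto
  have "closure (g' u ` cball 0 1) \<subseteq> (\<Union>x\<in>F. cball x (e/2))"
    using F(1) by (intro closure_minimal closed_UN order_trans[OF F(2)] UN_mono ball_subset_cball) auto
  also have "\<dots> \<subseteq> (\<Union>x\<in>F. ball x e)" using e by (intro UN_mono) (auto simp: subset_iff)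
  finally show "\<exists>k. finite k \<and> closure (g' u ` cball 0 1) \<subseteq> (\<Union>x\<in>k. ball x e)" using F(1) by blast
qed

text \<open>Project onto the span of a finite \<open>e\<close>-net: net points are fixed and the
  residual map is nonexpansive, so the error is at most the distance to the net.\<close>

lemma finite_rank_approximation:
  assumes "0 < e"
  obtains C where "orthonormal C" "norm (g' u - (orth_proj C o\<^sub>L g' u)) \<le> e"
proof -
  obtain F where F: "finite F" "g' u ` cball 0 1 \<subseteq> (\<Union>x\<in>F. ball x e)"
    using derivative_totally_bounded[OF assms] .
  obtain C where C: "orthonormal C" "span C = span F" using orthonormal_basis_exists[OF F(1)] .
  have unit: "norm (g' u h - orth_proj C (g' u h)) \<le> e" if "norm h \<le> 1" for h
  proof -
    have "g' u h \<in> (\<Union>x\<in>F. ball x e)" using that by (intro subsetD[OF F(2)] imageI) simp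
    then obtain y where y: "y \<in> F" "norm (g' u h - y) < e"
      by (auto simp: dist_norm norm_minus_commute)
    have "orth_proj C y = y" using y(1) C by (intro proj_id_span) (auto intro: span_base)
    then have "g' u h - orth_proj C (g' u h) = (g' u h - y) - orth_proj C (g' u h - y)"
      by (simp add: blinfun.diff_right)
    then have "norm (g' u h - orth_proj C (g' u h)) \<le> norm (g' u h - y)"
      using norm_diff_proj[OF C(1), of "g' u h - y"] by metis
    then show ?thesis using y(2) by linarith
  qed
  have "norm ((g' u - (orth_proj C o\<^sub>L g' u)) h) \<le> e * norm h" for h
  proof (cases "h = 0")
    case False
    have "norm ((g' u - (orth_proj C o\<^sub>L g' u)) (h /\<^sub>R norm h)) \<le> e"
      using unit[of "h /\<^sub>R norm h"] False by (simp add: blinfun.diff_left)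
    then show ?thesis using False by (simp add: blinfun.scaleR_right field_simps)
  qed simp
  then have "norm (g' u - (orth_proj C o\<^sub>L g' u)) \<le> e"
    using assms by (intro norm_blinfun_bound) auto
  then show ?thesis using that C(1) by blast
qed

text \<open>Otherwise there are unit vectors with \<open>t' u (X n)\<close> tending to 0.
  Compactness of \<open>g' u\<close> makes a subsequence converge, and its limit is a unit vector in
  the kernel.\<close>

lemma derivative_bounded_below:
  assumes "inj (blinfun_apply (t' u))"
  obtains c where "0 < c" "\<And>x. c * norm x \<le> norm (t' u x)"
proof (rule ccontr)
  assume contra: "\<not> thesis"
  have "\<exists>x. norm x = 1 \<and> norm (t' u x) < 1 / real (Suc n)" for n
  proof -
    have "\<not> (\<forall>x. 1 / real (Suc n) * norm x \<le> norm (t' u x))"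
      using contra that[of "1 / real (Suc n)"] by auto
    then obtain x where x: "norm (t' u x) < 1 / real (Suc n) * norm x" by (auto simp: not_le)
    then have "x \<noteq> 0" by auto
    then show ?thesis using x
      by (intro exI[of _ "x /\<^sub>R norm x"]) (simp add: blinfun.scaleR_right field_simps)
  qed
  then obtain X where X: "\<And>n. norm (X n) = 1" "\<And>n. norm (t' u (X n)) < 1 / real (Suc n)" by metis
  have "g' u (X n) \<in> closure (g' u ` cball 0 1)" for n
    using X by (intro subsetD[OF closure_subset] imageI) simp
  then obtain z r where r: "strict_mono r" "((\<lambda>n. g' u (X n)) \<circ> r) \<longlonglongrightarrow> z"
    using compact_derivative[of u] unfolding compact_def by meson
  have "(\<lambda>n. t' u (X n)) \<longlonglongrightarrow> 0"
    using X(2) by (intro LIMSEQ_norm_0) simp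
  from LIMSEQ_subseq_LIMSEQ[OF this r(1)] have t0: "(\<lambda>n. t' u (X (r n))) \<longlonglongrightarrow> 0" by (simp add: o_def)
  then have "(\<lambda>n. t' u (X (r n)) - g' u (X (r n))) \<longlonglongrightarrow> 0 - z"
    using r(2) by (intro tendsto_diff) (auto simp: o_def)
  then have Xr: "(\<lambda>n. X (r n)) \<longlonglongrightarrow> - z" by (simp add: t'_apply)
  have "(\<lambda>n. t' u (X (r n))) \<longlonglongrightarrow> t' u (- z)" by (intro tendsto_intros Xr)
  then have "t' u (- z) = t' u 0" using t0 LIMSEQ_unique by (metis blinfun.zero_right)
  then have "- z = 0" using assms by (meson injD)
  moreover have "(\<lambda>n. norm (X (r n))) \<longlonglongrightarrow> norm (- z)" by (intro tendsto_norm Xr)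
  then have "norm (- z) = 1" using X(1) by (simp add: LIMSEQ_const_iff)
  ultimately show False by simp
qed

text \<open>At a bijective \<open>t' u\<close> the lower bound \<open>c\<close> exists, and by
  continuity of \<open>g'\<close> nearby derivatives are perturbations of size below
  \<open>c / 2\<close>, hence bijective.\<close>

lemma closed_crit: "closed crit"
proof -
  have "open {u. bij (blinfun_apply (t' u))}"
    unfolding open_dist
  proof (intro ballI)
    fix u assume "u \<in> {u. bij (blinfun_apply (t' u))}"
    then have b: "bij (blinfun_apply (t' u))" by simp
    obtain c where c: "0 < c" "\<And>x. c * norm x \<le> norm (t' u x)"
      using derivative_bounded_below[OF bij_is_inj[OF b]] by blast
    obtain e where e: "0 < e" "\<And>w. dist w u < e \<Longrightarrow> dist (g' w) (g' u) < c / 2"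
      using cont c(1) unfolding continuous_on_iff by (metis UNIV_I half_gt_zero)
    have "bij (blinfun_apply (t' w))" if "dist w u < e" for w
    proof -
      have "bij (blinfun_apply (t' u + (g' w - g' u)))"
        using e(2)[OF that] c bij_is_surj[OF b]
        by (intro bij_perturbation[where c = c]) (auto simp: dist_norm)
      then show ?thesis by (simp add: t'_def)
    qed
    then show "\<exists>e>0. \<forall>w. dist w u < e \<longrightarrow> w \<in> {u. bij (blinfun_apply (t' u))}" using e(1) by auto
  qed
  moreover have "crit = - {u. bij (blinfun_apply (t' u))}" by (auto simp: crit_def)
  ultimately show ?thesis by (simp add: closed_def)
qed

section \<open>First-order estimates for \<open>g\<close>\<close>

text \<open>This is the mean value inequality for \<open>g - D\<close>.\<close>

lemma linearization_bound:
  assumes "convex S" "\<And>w. w \<in> S \<Longrightarrow> norm (g' w - D) \<le> e" "x \<in> S" "y \<in> S"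
  shows "norm (g x - g y - D (x - y)) \<le> e * norm (x - y)"
proof -
  have "norm ((g x - D x) - (g y - D y)) \<le> e * norm (x - y)"
  proof (rule differentiable_bound[OF assms(1) _ _ assms(3,4)])
    fix w assume "w \<in> S"
    have "((\<lambda>w. g w - D w) has_derivative (\<lambda>h. g' w h - D h)) (at w)"
      by (intro has_derivative_diff deriv blinfun.bounded_linear_right bounded_linear_imp_has_derivative)
    then show "((\<lambda>w. g w - D w) has_derivative blinfun_apply (g' w - D)) (at w within S)"
      by (simp add: minus_blinfun.rep_eq has_derivative_at_withinI)
    show "onorm (blinfun_apply (g' w - D)) \<le> e"
      using assms(2)[OF \<open>w \<in> S\<close>] by (simp add: norm_blinfun.rep_eq)
  qed
  then show ?thesis by (simp add: blinfun.diff_right algebra_simps)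
qed

text \<open>Only \<open>u\<close> is confined to the compact set; \<open>w\<close> and the segment
  joining them may leave it. A subsequence argument still makes the continuity of \<open>g'\<close>
  uniform there.\<close>

lemma uniform_linearization:
  assumes "compact K" "0 < e"
  obtains d where "0 < d"
    "\<And>u w. u \<in> K \<Longrightarrow> dist u w < d \<Longrightarrow> norm (g w - g u - g' u (w - u)) \<le> e * norm (w - u)"
proof -
  have "\<exists>d>0. \<forall>u\<in>K. \<forall>w. dist u w < d \<longrightarrow> norm (g' w - g' u) \<le> e"
  proof (rule ccontr)
    assume contra: "\<not> ?thesis"
    have "\<exists>u w. u \<in> K \<and> dist u w < 1 / real (Suc n) \<and> e < norm (g' w - g' u)" for n
    proof -
      have "0 < 1 / real (Suc n)" by simp
      with contra show ?thesis by (meson not_le)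
    qed
    then obtain X Y where X: "\<And>n. X n \<in> K" and Y: "\<And>n. dist (X n) (Y n) < 1 / real (Suc n)"
      and far: "\<And>n. e < norm (g' (Y n) - g' (X n))" by metis
    obtain l r where r: "strict_mono r" "(X \<circ> r) \<longlonglongrightarrow> l"
      using assms(1) X unfolding compact_def by meson
    have "(\<lambda>n. dist (X n) (Y n)) \<longlonglongrightarrow> 0"
    proof (rule real_tendsto_sandwich[OF _ _ tendsto_const])
      show "(\<lambda>n. 1 / real (Suc n)) \<longlonglongrightarrow> 0"
        using LIMSEQ_inverse_real_of_nat by (simp add: inverse_eq_divide)
    qed (use Y in \<open>auto intro!: always_eventually less_imp_le\<close>)
    from LIMSEQ_subseq_LIMSEQ[OF this r(1)] have "(\<lambda>n. X (r n) - Y (r n)) \<longlonglongrightarrow> 0"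
      by (simp add: o_def dist_norm tendsto_norm_zero_iff)
    moreover have Xr: "(\<lambda>n. X (r n)) \<longlonglongrightarrow> l" using r(2) by (simp add: o_def)
    ultimately have "(\<lambda>n. X (r n) - (X (r n) - Y (r n))) \<longlonglongrightarrow> l - 0" by (intro tendsto_diff)
    then have Yr: "(\<lambda>n. Y (r n)) \<longlonglongrightarrow> l" by simp
    have "(\<lambda>n. norm (g' (Y (r n)) - g' (X (r n)))) \<longlonglongrightarrow> norm (g' l - g' l)"
      by (intro tendsto_norm tendsto_diff tendsto_g' Xr Yr)
    then have "(\<lambda>n. norm (g' (Y (r n)) - g' (X (r n)))) \<longlonglongrightarrow> 0" by simp
    then have "e \<le> 0" using far by (intro LIMSEQ_le_const) (auto intro: less_imp_le)
    then show False using assms(2) by simp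
  qed
  then obtain d where d: "0 < d" "\<And>u w. u \<in> K \<Longrightarrow> dist u w < d \<Longrightarrow> norm (g' w - g' u) \<le> e" by blast
  have "norm (g w - g u - g' u (w - u)) \<le> e * norm (w - u)" if "u \<in> K" "dist u w < d" for u w
    by (rule linearization_bound[of "ball u d"]) (use d that in auto)
  then show ?thesis using that d(1) by blast
qed

text \<open>
  With \<open>P\<close> a finite-rank projection close to the identity on the image of the unit ball under \<open>K = g' u0\<close>, the map
  \<open>s u = t u - P (K u)\<close> is bi-Lipschitz near \<open>u0\<close>. On the preimage of \<open>y + span C\<close> it takes values in
  \<open>y + span C\<close> as well, so \<open>s u \<mapsto> t u\<close> is a finite-dimensional map to which \<open>sard_grid\<close> applies.
\<close>

lemma local_sard:
  obtains r where "0 < r" "\<And>y \<rho>. 0 < \<rho> \<Longrightarrow> \<not> ball y \<rho> \<subseteq> t ` (crit \<inter> cball u0 r)"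
proof -
  define K where "K = g' u0"
  \<comment> \<open>This 1/4 and the 1/4 from continuity of \<open>g'\<close> add up to the 1/2 that
    \<open>bij_perturbation\<close> tolerates around the identity.\<close>
  obtain C where C: "orthonormal C" and KC: "norm (K - (orth_proj C o\<^sub>L K)) \<le> 1/4"
    using finite_rank_approximation[of "1/4" u0] unfolding K_def by auto
  define k where "k = orth_proj C o\<^sub>L K"
  have k_span: "k v \<in> span C" for v by (simp add: k_def proj_in_span)
  obtain d where d: "0 < d" "\<And>w. dist w u0 < d \<Longrightarrow> dist (g' w) K < 1/4"
    using cont unfolding continuous_on_iff K_def by (metis UNIV_I zero_less_divide_1_iff zero_less_numeral)
  define r where "r = d / 2"
  have r: "0 < r" using d by (simp add: r_def)
  have near: "norm (g' w - k) \<le> 1/2" if "w \<in> cball u0 r" for w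
  proof -
    have "dist w u0 < d" using that r by (auto simp: r_def dist_commute)
    then have "norm (g' w - K) < 1/4" using d(2) by (simp add: dist_norm)
    then have "norm ((g' w - K) + (K - k)) \<le> 1/4 + 1/4"
      using KC by (intro norm_triangle_le) (simp add: k_def)
    then show ?thesis by simp
  qed
  \<comment> \<open>\<open>M w\<close> is the derivative at \<open>w\<close> of the map
    \<open>s\<close> below, and \<open>t' w = M w + k\<close> with \<open>k\<close> of finite
    rank.\<close>
  define M where "M w = id_blinfun + (g' w - k)" for w
  have Mbij: "bij (blinfun_apply (M w))" "norm x \<le> 2 * norm (M w x)" if "w \<in> cball u0 r" for w x
    using bij_perturbation(1)[of 1 id_blinfun "g' w - k"] bij_perturbation(2)[of 1 id_blinfun "g' w - k" x]
      near[OF that] by (auto simp: M_def id_blinfun.rep_eq)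
  have M_apply: "M w x = x + g' w x - k x" for w x
    by (simp add: M_def blinfun.add_left blinfun.diff_left)
  define s where "s u = t u - k u" for u
  have s_expand: "norm (u - w) \<le> 2 * norm (s u - s w)" if "u \<in> cball u0 r" "w \<in> cball u0 r" for u w
  proof -
    have "norm (g u - g w - k (u - w)) \<le> 1/2 * norm (u - w)"
      by (rule linearization_bound[OF convex_cball near that])
    moreover have "s u - s w = (u - w) + (g u - g w - k (u - w))"
      by (simp add: s_def t_def blinfun.diff_right)
    ultimately show ?thesis
      using norm_triangle_ineq4[of "s u - s w" "g u - g w - k (u - w)"] by simp
  qed
  have False if \<rho>: "0 < \<rho>" and sub: "ball y \<rho> \<subseteq> t ` (crit \<inter> cball u0 r)" for y \<rho>
  proof -
    define n where "n = real (card C)"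
    \<comment> \<open>A box of coordinates up to \<open>\<rho>'\<close> has norm at most
      \<open>n * \<rho>' < \<rho>\<close>, so it fits into the ball.\<close>
    define \<rho>' where "\<rho>' = \<rho> / (n + 1)"
    have n: "0 \<le> n" and \<rho>': "0 < \<rho>'" "n * \<rho>' < \<rho>" using \<rho> by (auto simp: \<rho>'_def n_def field_simps)
    \<comment> \<open>Compactness of \<open>Q\<close> passes to its preimage under \<open>t\<close>,
      where first-order expansions then hold uniformly.\<close>
    define Q where "Q = (+) y ` {\<Sum>c\<in>C. x c *\<^sub>R c | x. \<forall>c\<in>C. \<bar>x c\<bar> \<le> \<rho>'}"
    define U where "U = {u \<in> crit \<inter> cball u0 r. t u \<in> Q}"
    have "compact Q"
      unfolding Q_def by (intro compact_translation compact_coordinate_box orthonormal_finite[OF C])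
    then have compU: "compact (t -` Q)" by (rule compact_preimage)
    have coord_span: "(\<Sum>c\<in>C. m c *\<^sub>R c) \<in> span C" for m by (intro span_sum span_scale span_base)
    have U: "u \<in> t -` Q" "u \<in> crit" "u \<in> cball u0 r" "t u - y \<in> span C" if "u \<in> U" for u
      using that coord_span by (auto simp: U_def Q_def)
    define x where "x u c = (s u - y) \<bullet> c" for u c
    define f where "f u c = (t u - y) \<bullet> c" for u c
    have x_diff: "x u c - x w c = (s u - s w) \<bullet> c" for u w c
      by (simp add: x_def inner_simps)
    have f_diff: "f u c - f w c = x u c - x w c + k (u - w) \<bullet> c" for u w c
      by (simp add: x_def f_def s_def inner_simps blinfun.diff_right)
    \<comment> \<open>Both \<open>t u - t w\<close> and the values of \<open>k\<close> lie in
      \<open>span C\<close>, so finitely many coordinates of \<open>s\<close> control the distance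
      on \<open>U\<close>.\<close>
    have s_span: "s u - s w \<in> span C" if "u \<in> U" "w \<in> U" for u w
    proof -
      have "s u - s w = (t u - y) - (t w - y) - k (u - w)" by (simp add: s_def blinfun.diff_right)
      then show ?thesis using U(4) that k_span by (metis span_diff)
    qed
    have s_close: "norm (s u - s w) \<le> n * \<delta>" if "u \<in> U" "w \<in> U" "\<And>c. c \<in> C \<Longrightarrow> \<bar>x u c - x w c\<bar> \<le> \<delta>" for u w \<delta>
      using norm_le_coord_sum[OF C s_span[OF that(1,2)], of \<delta>] that(3) by (simp add: x_diff n_def)
    have u_close: "norm (u - w) \<le> 2 * (n * \<delta>)" if "u \<in> U" "w \<in> U" "\<And>c. c \<in> C \<Longrightarrow> \<bar>x u c - x w c\<bar> \<le> \<delta>" for u w \<delta>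
      using s_expand[OF U(3)[OF that(1)] U(3)[OF that(2)]] s_close[OF that] by linarith
    \<comment> \<open>By \<open>f_diff\<close> a coordinate of \<open>t\<close> varies by at most
      \<open>\<delta>\<close> from \<open>s\<close> plus
      \<open>norm k * (2 * (n * \<delta>))\<close> from \<open>k\<close>.\<close>
    obtain L :: nat where L: "1 + 2 * norm k * n \<le> real L" using real_arch_simple by blast
    define b where "b = norm (s u0) + 2 * r"
    have b: "norm (s w) \<le> b" if w: "w \<in> cball u0 r" for w
    proof -
      have "norm (g w - g u0 - k (w - u0)) \<le> 1/2 * norm (w - u0)"
        by (rule linearization_bound[OF convex_cball near]) (use w r in auto)
      moreover have eq: "s w = s u0 + (w - u0) + (g w - g u0 - k (w - u0))"
        by (simp add: s_def t_def blinfun.diff_right)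
      moreover have "norm (w - u0) \<le> r" using w by (simp add: dist_norm norm_minus_commute)
      ultimately show ?thesis
        unfolding eq b_def using r norm_triangle_ineq[of "s u0" "w - u0"]
          norm_triangle_ineq[of "s u0 + (w - u0)" "g w - g u0 - k (w - u0)"] by linarith
    qed
    have b0: "0 \<le> b" using r by (simp add: b_def)
    show False
    proof (rule sard_grid[where I = C and U = U and x = x and f = f and \<rho> = \<rho>' and L = L and R = "b + norm y + 1"])
      show "finite C" by (rule orthonormal_finite[OF C])
      show "0 < \<rho>'" by (rule \<rho>')
      show "0 < b + norm y + 1" using b0 by (simp add: add_nonneg_pos)
      show "\<bar>x u c\<bar> \<le> b + norm y + 1" if "u \<in> U" "c \<in> C" for u c
      proof -
        have "\<bar>x u c\<bar> \<le> norm (s u - y) * norm c" unfolding x_def by (rule Cauchy_Schwarz_ineq2)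
        also have "\<dots> \<le> norm (s u) + norm y"
          using norm_triangle_ineq4[of "s u" y] by (simp add: orthonormal_norm[OF C that(2)])
        also have "\<dots> \<le> b + norm y + 1" using b[OF U(3)[OF that(1)]] by simp
        finally show ?thesis .
      qed
      show "\<exists>u\<in>U. \<forall>c\<in>C. f u c = m c" if m: "\<And>c. c \<in> C \<Longrightarrow> m c \<in> {0..\<rho>'}" for m
      proof -
        define z where "z = (\<Sum>c\<in>C. m c *\<^sub>R c)"
        have z: "z \<in> span C" unfolding z_def by (rule coord_span)
        have zc: "z \<bullet> c = m c" if "c \<in> C" for c
        proof -
          have "z \<bullet> c = (\<Sum>e\<in>C. if e = c then m e else 0)"
            unfolding z_def inner_sum_left using C that by (intro sum.cong) (auto simp: orthonormal_def)
          then show ?thesis using orthonormal_finite[OF C] that by simp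
        qed
        have "norm z \<le> n * \<rho>'" unfolding n_def using m
          by (intro norm_le_coord_sum[OF C z]) (auto simp: zc)
        then have "y + z \<in> ball y \<rho>" using \<rho>' by (simp add: dist_norm)
        then obtain u where u: "u \<in> crit \<inter> cball u0 r" "t u = y + z" using sub by (metis imageE subsetD)
        have "y + z \<in> Q" unfolding Q_def z_def using m by (intro imageI) auto
        then show ?thesis using u by (intro bexI[of _ u]) (auto simp: U_def f_def zc)
      qed
      show "\<bar>f u' c - f u c\<bar> \<le> real L * \<delta>"
        if "0 < \<delta>" "u \<in> U" "u' \<in> U" and close: "\<And>c. c \<in> C \<Longrightarrow> \<bar>x u' c - x u c\<bar> \<le> \<delta>" and "c \<in> C" for \<delta> u u' c
      proof -
        have "\<bar>k (u' - u) \<bullet> c\<bar> \<le> norm (k (u' - u)) * norm c" by (rule Cauchy_Schwarz_ineq2)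
        also have "\<dots> \<le> norm k * norm (u' - u)"
          using norm_blinfun[of k "u' - u"] by (simp add: orthonormal_norm[OF C \<open>c \<in> C\<close>])
        also have "\<dots> \<le> norm k * (2 * (n * \<delta>))"
          by (intro mult_left_mono u_close that close) auto
        finally have "\<bar>f u' c - f u c\<bar> \<le> (1 + 2 * norm k * n) * \<delta>"
          using close[OF \<open>c \<in> C\<close>] by (simp add: f_diff algebra_simps)
        also have "\<dots> \<le> real L * \<delta>" using L that(1) by (intro mult_right_mono) auto
        finally show ?thesis .
      qed
      fix \<epsilon> :: real assume \<epsilon>: "0 < \<epsilon>"
      \<comment> \<open>Chosen for the closing estimate, which has the factor
        \<open>4 * (n * (n * norm k))\<close>; the added 1 keeps the denominator positive when that
        factor vanishes.\<close>
      define \<epsilon>' where "\<epsilon>' = \<epsilon> / (4 * (n * (n * norm k)) + 1)"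
      have \<epsilon>': "0 < \<epsilon>'" unfolding \<epsilon>'_def using \<epsilon> n by (intro divide_pos_pos) (auto intro: add_nonneg_pos)
      have \<epsilon>'_le: "4 * (n * (n * norm k)) * \<epsilon>' \<le> \<epsilon>"
      proof -
        have "0 < 4 * (n * (n * norm k)) + 1" using n by (auto intro: add_nonneg_pos)
        then have "(4 * (n * (n * norm k)) + 1) * \<epsilon>' = \<epsilon>" unfolding \<epsilon>'_def by simp
        then show ?thesis using \<epsilon>' by (simp add: algebra_simps)
      qed
      obtain e where e: "0 < e" and lin: "\<And>u w. u \<in> t -` Q \<Longrightarrow> dist u w < e \<Longrightarrow>
          norm (g w - g u - g' u (w - u)) \<le> \<epsilon>' * norm (w - u)"
        using uniform_linearization[OF compU \<epsilon>'] by blast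
      show "\<exists>\<delta>0>0. \<forall>\<delta>. 0 < \<delta> \<longrightarrow> \<delta> \<le> \<delta>0 \<longrightarrow> (\<forall>u\<in>U. \<exists>a. \<exists>j\<in>C. a j = 1 \<and>
          (\<forall>u'\<in>U. (\<forall>i\<in>C. \<bar>x u' i - x u i\<bar> \<le> \<delta>) \<longrightarrow> \<bar>\<Sum>i\<in>C. a i * (f u' i - f u i)\<bar> \<le> \<epsilon> * \<delta>))"
      \<comment> \<open>Coordinates within \<open>\<delta>\<close> mean a distance of at most
        \<open>2 * (n * \<delta>)\<close>, which this choice keeps strictly below
        \<open>e\<close>.\<close>
      proof (intro exI[of _ "e / (2 * n + 1)"] conjI allI impI ballI)
        show "0 < e / (2 * n + 1)" using e n by simp
        fix \<delta> u assume \<delta>: "0 < \<delta>" "\<delta> \<le> e / (2 * n + 1)" and u: "u \<in> U"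
        have "(2 * n + 1) * \<delta> \<le> e" using \<delta>(2) n by (simp add: field_simps)
        then have small: "2 * (n * \<delta>) < e" using \<delta>(1) by (simp add: algebra_simps)
        have "\<not> bij (blinfun_apply (M u + k))"
          using U(2)[OF u] by (simp add: crit_def M_def t'_def)
        then obtain a where a: "a \<in> span C" "a \<noteq> 0" "\<And>v. M u v \<in> span C \<Longrightarrow> a \<bullet> M u v = - (a \<bullet> k v)"
          using left_null_vector[OF C Mbij(1)[OF U(3)[OF u]] k_span] by blast
        have Cne: "C \<noteq> {}" using a by auto
        \<comment> \<open>Dividing by the coordinate of largest modulus makes it 1 and all others at
          most 1 in modulus, hence \<open>norm a' \<le> n\<close>.\<close>
        obtain j where j: "j \<in> C" "\<And>c. c \<in> C \<Longrightarrow> \<bar>a \<bullet> c\<bar> \<le> \<bar>a \<bullet> j\<bar>"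
        proof -
          have "Max ((\<lambda>c. \<bar>a \<bullet> c\<bar>) ` C) \<in> (\<lambda>c. \<bar>a \<bullet> c\<bar>) ` C"
            using orthonormal_finite[OF C] Cne by (intro Max_in) auto
          then obtain j where "j \<in> C" "\<bar>a \<bullet> j\<bar> = Max ((\<lambda>c. \<bar>a \<bullet> c\<bar>) ` C)" by auto
          then show ?thesis using that[of j] orthonormal_finite[OF C] by simp
        qed
        have aj: "a \<bullet> j \<noteq> 0"
        proof
          assume "a \<bullet> j = 0"
          then have "norm a \<le> real (card C) * 0" using j by (intro norm_le_coord_sum[OF C a(1)]) auto
          then show False using a(2) by simp
        qed
        define a' where "a' = a /\<^sub>R (a \<bullet> j)"
        have a': "a' \<in> span C" unfolding a'_def by (intro span_scale a)
        have a'M: "a' \<bullet> M u v = - (a' \<bullet> k v)" if "M u v \<in> span C" for v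
          using a(3)[OF that] by (simp add: a'_def)
        have norm_a': "norm a' \<le> n"
          using norm_le_coord_sum[OF C a', of 1] j aj by (simp add: a'_def n_def divide_simps abs_mult)
        show "\<exists>a. \<exists>j\<in>C. a j = 1 \<and>
          (\<forall>u'\<in>U. (\<forall>i\<in>C. \<bar>x u' i - x u i\<bar> \<le> \<delta>) \<longrightarrow> \<bar>\<Sum>i\<in>C. a i * (f u' i - f u i)\<bar> \<le> \<epsilon> * \<delta>)"
        proof (intro exI[of _ "\<lambda>c. a' \<bullet> c"] bexI[of _ j] conjI ballI impI)
          show "a' \<bullet> j = 1" using aj by (simp add: a'_def)
          show "j \<in> C" by (rule j)
          fix u' assume u': "u' \<in> U" and close: "\<forall>i\<in>C. \<bar>x u' i - x u i\<bar> \<le> \<delta>"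
          define h where "h = u' - u"
          have h: "norm h \<le> 2 * (n * \<delta>)" unfolding h_def using u_close[OF u' u] close by blast
          \<comment> \<open>\<open>v\<close> is what \<open>h\<close> would be if \<open>s\<close>
            were affine. Pairing with \<open>a'\<close> cancels \<open>M u v + k v\<close>, leaving
            \<open>k (h - v)\<close>, and \<open>M u (h - v)\<close> is minus the Taylor remainder
            of \<open>g\<close>.\<close>
          obtain v where v: "M u v = s u' - s u"
            using Mbij(1)[OF U(3)[OF u]] by (metis bij_pointE)
          have "(\<Sum>c\<in>C. (a' \<bullet> c) * (f u' c - f u c)) = a' \<bullet> (t u' - t u)"
            unfolding orthonormal_inner_expand[OF C a', of "t u' - t u"]
            by (intro sum.cong) (simp_all add: f_def inner_diff_left)
          also have "t u' - t u = M u v + k h"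
            by (simp add: v s_def h_def blinfun.diff_right)
          also have "a' \<bullet> (M u v + k h) = a' \<bullet> k (h - v)"
            using a'M[of v] s_span[OF u' u] by (simp add: v inner_simps blinfun.diff_right)
          finally have sum_eq: "(\<Sum>c\<in>C. (a' \<bullet> c) * (f u' c - f u c)) = a' \<bullet> k (h - v)" .
          have "M u (h - v) = - (g u' - g u - g' u h)"
            by (simp add: blinfun.diff_right v) (simp add: M_apply s_def t_def h_def blinfun.diff_right)
          then have "norm (M u (h - v)) = norm (g u' - g u - g' u h)" by (simp only: norm_minus_cancel)
          moreover have "norm (g u' - g u - g' u h) \<le> \<epsilon>' * norm h"
            unfolding h_def using h small u' u
            by (intro lin U(1)) (auto simp: h_def dist_norm norm_minus_commute)
          ultimately have "norm (h - v) \<le> 2 * (\<epsilon>' * norm h)"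
            using Mbij(2)[OF U(3)[OF u], of "h - v"] by linarith
          also have "\<dots> \<le> 2 * (\<epsilon>' * (2 * (n * \<delta>)))" using h \<epsilon>' by (intro mult_left_mono) auto
          finally have hv: "norm (h - v) \<le> 2 * (\<epsilon>' * (2 * (n * \<delta>)))" .
          have "\<bar>a' \<bullet> k (h - v)\<bar> \<le> norm a' * norm (k (h - v))" by (rule Cauchy_Schwarz_ineq2)
          also have "\<dots> \<le> n * (norm k * norm (h - v))"
            using norm_a' n by (intro mult_mono norm_blinfun) auto
          also have "\<dots> \<le> n * (norm k * (2 * (\<epsilon>' * (2 * (n * \<delta>)))))"
            using hv n by (intro mult_left_mono) auto
          also have "\<dots> = (4 * (n * (n * norm k)) * \<epsilon>') * \<delta>" by (simp add: mult_ac)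
          also have "\<dots> \<le> \<epsilon> * \<delta>" using \<epsilon>'_le \<delta>(1) by (intro mult_right_mono) auto
          finally show "\<bar>\<Sum>c\<in>C. (a' \<bullet> c) * (f u' c - f u c)\<bar> \<le> \<epsilon> * \<delta>" by (simp only: sum_eq)
        qed
      qed
    qed
  qed
  then show ?thesis using that r by blast
qed

section \<open>Critical values and regular fibres\<close>

text \<open>The fibre over \<open>y\<close> is compact, so finitely many balls from
  \<open>local_sard\<close> cover it. As \<open>t\<close> is a closed map, all preimages of points
  near \<open>y\<close> lie in these balls, so the critical values near \<open>y\<close> lie in
  finitely many closed sets without interior.\<close>

lemma critical_values_no_ball:
  assumes "0 < \<rho>"
  shows "\<not> ball y \<rho> \<subseteq> t ` crit"
proof
  assume sub: "ball y \<rho> \<subseteq> t ` crit"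
  have "\<exists>r>0. \<forall>y \<rho>. 0 < \<rho> \<longrightarrow> \<not> ball y \<rho> \<subseteq> t ` (crit \<inter> cball u r)" for u
  proof (rule local_sard[of u])
    fix r assume "0 < r" "\<And>y \<rho>. 0 < \<rho> \<Longrightarrow> \<not> ball y \<rho> \<subseteq> t ` (crit \<inter> cball u r)"
    then show ?thesis by (intro exI[of _ r]) simp
  qed
  then obtain r where r: "\<And>u. 0 < r u" "\<And>u y \<rho>. 0 < \<rho> \<Longrightarrow> \<not> ball y \<rho> \<subseteq> t ` (crit \<inter> cball u (r u))"
    by metis
  have "compact (t -` {y})" by (intro compact_preimage) simp
  then obtain D where D: "D \<subseteq> t -` {y}" "finite D" "t -` {y} \<subseteq> (\<Union>u\<in>D. ball u (r u))"
    using r(1) by (elim compactE_image[of _ "t -` {y}" "\<lambda>u. ball u (r u)"]) auto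
  define O' where "O' = (\<Union>u\<in>D. ball u (r u))"
  have "closed (t ` (- O'))" by (intro closed_image) (auto simp: O'_def closed_Compl)
  moreover have "y \<notin> t ` (- O')" using D(3) by (auto simp: O'_def)
  ultimately obtain e where e: "0 < e" "ball y e \<inter> t ` (- O') = {}"
    by (metis ComplI disjoint_eq_subset_Compl open_Compl open_contains_ball)
  have "\<not> ball y (min e \<rho>) \<subseteq> \<Union>((\<lambda>u. t ` (crit \<inter> cball u (r u))) ` D)"
    using D(2) r assms e(1)
    by (intro finite_nowhere_dense_union) (auto intro!: closed_image closed_Int closed_crit)
  then obtain z where z: "z \<in> ball y (min e \<rho>)" "\<And>u. u \<in> D \<Longrightarrow> z \<notin> t ` (crit \<inter> cball u (r u))"
    by blast
  then obtain w where w: "w \<in> crit" "t w = z" using sub by (metis imageE min_less_iff_conj mem_ball subsetD)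
  have "w \<in> O'" using e(2) w z(1) by auto
  then obtain u where "u \<in> D" "w \<in> ball u (r u)" by (auto simp: O'_def)
  then show False using z(2)[of u] w by (auto intro: less_imp_le)
qed

text \<open>An infinite compact fibre has a limit point \<open>l\<close>. There \<open>t' l\<close>
  is bounded below by \<open>c\<close>, while the remainder of \<open>g\<close> is at most half of
  that, so no other point of the fibre is near \<open>l\<close>.\<close>

lemma finite_preimage:
  assumes "y \<notin> t ` crit"
  shows "finite (t -` {y})"
proof (rule ccontr)
  assume "infinite (t -` {y})"
  moreover have "compact (t -` {y})" by (intro compact_preimage) simp
  ultimately obtain l where l: "l \<in> t -` {y}" "l islimpt (t -` {y})"
    by (meson compact_eq_Bolzano_Weierstrass order_refl)
  have b: "bij (blinfun_apply (t' l))" using assms l(1) by (auto simp: crit_def)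
  obtain c where c: "0 < c" "\<And>x. c * norm x \<le> norm (t' l x)"
    using derivative_bounded_below[OF bij_is_inj[OF b]] by blast
  obtain d where d: "0 < d" "\<And>w. norm (w - l) < d \<Longrightarrow> norm (g w - g l - g' l (w - l)) \<le> c / 2 * norm (w - l)"
    using deriv[of l] c(1) unfolding has_derivative_at_alt by (meson half_gt_zero)
  obtain w where w: "t w = y" "w \<noteq> l" "dist w l < d"
    using l(2) d(1) unfolding islimpt_approachable by (metis vimage_singleton_eq)
  have "w + g w = l + g l" using w(1) l(1) by (simp add: t_def)
  then have "t' l (w - l) = - (g w - g l - g' l (w - l))" by (simp add: t'_apply algebra_simps)
  then have "norm (t' l (w - l)) = norm (g w - g l - g' l (w - l))" by (simp only: norm_minus_cancel)
  then have "c * norm (w - l) \<le> c / 2 * norm (w - l)"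
    using c(2)[of "w - l"] d(2)[of w] w(3) unfolding dist_norm by linarith
  then show False using c(1) w(2) by simp
qed

end

section \<open>Transfer to the dual space by the Riesz isometry\<close>

theorem theorem2p2:
  fixes G :: "'v::{real_inner, complete_space} \<Rightarrow> 'v \<Rightarrow>\<^sub>L real"
  assumes "C1 G"
    and "compact_operator G"
    and "weakly_coercive (op_T G)"
  shows "open (regular_rhs G)
    \<and> closure (regular_rhs G) = UNIV
    \<and> (\<forall>F\<in>regular_rhs G. finite {u. is_root (op_N G F) u} \<and> finite (op_T G -` {F}))"
proof -
  obtain G' where dG: "\<And>x. (G has_derivative blinfun_apply (G' x)) (at x)" and cG: "continuous_on UNIV G'"
    using assms(1) unfolding C1_def by blast
  define J where "J = inv (op_A :: 'v \<Rightarrow> _)"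
  have AJ: "op_A (J F) = F" for F
    unfolding J_def by (rule surj_f_inv_f[OF bij_is_surj[OF bij_op_A]])
  have JA: "J (op_A v) = v" for v
    unfolding J_def by (rule inv_f_f[OF bij_is_inj[OF bij_op_A]])
  have norm_J: "norm (J F) = norm F" for F using norm_op_A[of "J F"] by (simp add: AJ)
  have A_scale: "op_A (s *\<^sub>R v) = s *\<^sub>R op_A v" for s and v :: 'v
    by (rule blinfun_eqI) (simp add: op_A_apply blinfun.bilinear_simps)
  have blJ: "bounded_linear J"
  proof (rule bounded_linear_intro[where K = 1])
    show "J (x + y) = J x + J y" for x y by (metis AJ JA op_A_add)
    show "J (s *\<^sub>R x) = s *\<^sub>R J x" for s x by (metis AJ JA A_scale)
  qed (simp add: norm_J)
  define JB where "JB = Blinfun J"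
  have JB: "blinfun_apply JB = J" unfolding JB_def by (rule bounded_linear_Blinfun_apply[OF blJ])
  define g where "g u = J (G u)" for u
  define g' where "g' u = JB o\<^sub>L G' u" for u
  have A_sum: "op_A (u + g u) = op_T G u" for u by (simp add: op_T_def g_def op_A_add AJ)
  interpret compact_perturbation g g'
  proof
    show "(g has_derivative blinfun_apply (g' u)) (at u)" for u
      using bounded_linear.has_derivative[OF blJ dG[of u]]
      by (simp add: g_def[abs_def] g'_def JB blinfun_compose.rep_eq o_def)
    show "continuous_on UNIV g'"
      unfolding g'_def
      by (intro bounded_bilinear.continuous_on[OF bounded_bilinear_blinfun_compose] continuous_on_const cG)
    show "compact (closure (g ` S))" if "bounded S" for S
    proof -
      have c: "compact (J ` closure (G ` S))"
        using assms(2) that unfolding compact_operator_def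
        by (intro compact_continuous_image linear_continuous_on blJ) auto
      have "g ` S \<subseteq> J ` closure (G ` S)" using closure_subset[of "G ` S"] by (auto simp: g_def)
      then have "closure (g ` S) \<subseteq> J ` closure (G ` S)"
        by (intro closure_minimal compact_imp_closed[OF c])
      then show ?thesis
        using compact_Int_closed[OF c closed_closure, of "g ` S"] by (simp add: Int_absorb1)
    qed
    show "bounded {u. u + g u \<in> S}" if S: "bounded S" for S
    proof -
      obtain b where b: "\<And>y. y \<in> S \<Longrightarrow> norm y \<le> b" using S by (auto simp: bounded_iff)
      \<comment> \<open>A point whose image has norm at most \<open>b\<close> must lie where this
        eventual bound fails, hence in a fixed ball.\<close>
      have "eventually (\<lambda>v. b < norm (op_T G v)) at_infinity"
        using assms(3) unfolding weakly_coercive_def filterlim_at_top_dense by blast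
      then obtain B where B: "\<And>v. B \<le> norm v \<Longrightarrow> b < norm (op_T G v)"
        unfolding eventually_at_infinity by blast
      have "norm u \<le> B" if "u + g u \<in> S" for u
      proof -
        have "\<not> b < norm (op_T G u)" using b[OF that] norm_op_A[of "u + g u"] by (simp add: A_sum)
        then show ?thesis by (meson B linear)
      qed
      then show ?thesis unfolding bounded_iff by blast
    qed
  qed
  have root: "is_root (op_N G F) u \<longleftrightarrow> t u = J F" for F u
  proof -
    have "is_root (op_N G F) u \<longleftrightarrow> op_A (t u) = F"
      by (simp add: is_root_def op_N_def t_def A_sum op_T_def)
    also have "\<dots> \<longleftrightarrow> t u = J F" using AJ JA by metis
    finally show ?thesis .
  qed
  have derivative: "frechet_derivative (op_N G F) (at u) = op_A \<circ> t' u" for F u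
    unfolding frechet_derivative_op_N[OF dG]
    by (simp add: fun_eq_iff t'_apply op_A_add g'_def JB AJ)
  \<comment> \<open>Composition with the bijection \<open>op_A\<close> or its inverse
    \<open>J\<close> does not affect bijectivity.\<close>
  have "bij (op_A \<circ> t' u) \<longleftrightarrow> u \<notin> crit" for u
  proof
    assume "bij (op_A \<circ> t' u)"
    moreover have "bij J" unfolding J_def by (intro bij_imp_bij_inv bij_op_A)
    ultimately have "bij (J \<circ> (op_A \<circ> t' u))" by (rule bij_comp)
    then show "u \<notin> crit" by (simp add: crit_def o_def JA)
  qed (auto simp: crit_def intro: bij_comp bij_op_A)
  \<comment> \<open>Openness and density are now read off in \<open>V\<close>: the critical values
    form a closed set without interior, and \<open>J\<close> is an isometry.\<close>
  then have regular: "regular_rhs G = J -` (- (t ` crit))"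
    by (fastforce simp: regular_rhs_def regular_root_def root derivative image_iff)
  have "open (regular_rhs G)"
    unfolding regular
    by (intro open_vimage linear_continuous_on blJ) (simp add: open_Compl closed_image closed_crit)
  moreover have "F \<in> closure (regular_rhs G)" for F
    unfolding closure_approachable
  proof (intro allI impI)
    fix e :: real assume "0 < e"
    then obtain y where y: "dist (J F) y < e" "y \<notin> t ` crit"
      using critical_values_no_ball[of e "J F"] by (auto simp: subset_iff)
    have "dist (op_A y) F = dist y (J F)"
      using norm_op_A[of "y - J F"] by (simp add: dist_norm op_A_diff AJ)
    then show "\<exists>H\<in>regular_rhs G. dist H F < e"
      using y by (intro bexI[of _ "op_A y"]) (auto simp: regular JA dist_commute)
  qed
  moreover have "finite {u. is_root (op_N G F) u} \<and> finite (op_T G -` {F})" if "F \<in> regular_rhs G" for F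
  proof -
    have "finite (t -` {J F})" using that by (intro finite_preimage) (simp add: regular)
    moreover have "{u. is_root (op_N G F) u} = t -` {J F}" by (auto simp: root)
    moreover have "op_T G -` {F} = {u. is_root (op_N G F) u}" by (auto simp: is_root_def op_N_def op_T_def)
    ultimately show ?thesis by simp
  qed
  ultimately show ?thesis by blast
qed

end
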